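(* Let $\mathcal{F}$ be a Lie foliation on a compact connected manifold $M$, let $G$ be the associated connected simply connected Lie group and $\Gamma\subset G$ the holonomy group. Then the groups $\mathrm{Diff}(M/\mathcal{F})$ and $\mathrm{Diff}(G/\Gamma)$ are isomorphic.
   Context: Let $\mathfrak{g}$ be a finite-dimensional real Lie algebra. A $\mathfrak{g}$-Lie foliation on a manifold $M$ is the foliation defined by the kernel of a non-degenerate (pointwise surjective) $1$-form $\omega$ with values in $\mathfrak{g}$ such that $d\omega=-\tfrac12[\omega,\omega]$. Let $G$ be the connected simply connected Lie group with Lie algebra $\mathfrak{g}$. When $M$ is compact it is well known that there exist a regular (connected) covering $p:\widetilde M\to M$, a locally trivial bundle $D:\widetilde M\to G$ (the developing map) whose fibres are the leaves of the lifted foliation $p^\star\mathcal{F}$, and a group morphism $h:\pi_1(M)\to G$ (the holonomy morphism) with $\ker h=\pi_1(\widetilde M)$ and such that $D$ is $h$-equivariant, i.e. $D(\gamma\cdot x)=h(\gamma)D(x)$ for the action by deck transformations. The image $\Gamma=h(\pi_1(M))$ is the holonomy group. The space of leaves $M/\mathcal{F}$ and the coset space $G/\Gamma$ have the quotient diffeology: plots are the maps from open sets $U$ of some $\mathbb{R}^p$ which locally lift to $\mathcal{C}^\infty$ maps into $M$ (respectively $G$). A map of diffeological spaces is differentiable if it carries plots to plots by composition, and $\mathrm{Diff}$ denotes the group of differentiable bijections with differentiable inverse. *)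

theory Defs
  imports "HOL-Analysis.Analysis" "HOL-Algebra.Left_Coset" "HOL-Algebra.Bij"
begin

text \<open>
  The dimension \<open>n\<close> of a manifold, and the dimension \<open>p\<close> of the domain of a plot, must be ordinary
  natural numbers (the latter is quantified inside the notion of a differentiable map, and
  dimension \<open>0\<close> has to be allowed). So the model of the \<open>n\<close>-dimensional space is
  \<^const>\<open>Euclidean_space\<close> \<open>n\<close>, the space of sequences vanishing from index \<open>n\<close> on.
\<close>

section \<open>Smooth functions on open subsets of Euclidean space\<close>

text \<open>\<open>C_diff k p U f\<close>: the function \<open>f\<close> is of class \<open>C\<^sup>k\<close> on the open subset \<open>U\<close> of
  \<open>Euclidean_space p\<close>, i.e. all iterated partial derivatives of order at most \<open>k\<close> exist on \<open>U\<close> and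
  are continuous there. As \<open>U\<close> is open, only values of \<open>f\<close> on \<open>U\<close> matter.\<close>

primrec C_diff :: "nat \<Rightarrow> nat \<Rightarrow> (nat \<Rightarrow> real) set \<Rightarrow> ((nat \<Rightarrow> real) \<Rightarrow> real) \<Rightarrow> bool" where
  "C_diff 0 p U f \<longleftrightarrow> continuous_on U f"
| "C_diff (Suc k) p U f \<longleftrightarrow> continuous_on U f \<and>
     (\<forall>i<p. \<exists>g. (\<forall>x\<in>U. ((\<lambda>t. f (x(i := t))) has_real_derivative g x) (at (x i))) \<and> C_diff k p U g)"

definition smooth_on :: "nat \<Rightarrow> (nat \<Rightarrow> real) set \<Rightarrow> ((nat \<Rightarrow> real) \<Rightarrow> real) \<Rightarrow> bool" where
  "smooth_on p U f \<longleftrightarrow> (\<forall>k. C_diff k p U f)"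


section \<open>Smooth manifolds and smooth maps\<close>

type_synonym 'm chart = "'m set \<times> ('m \<Rightarrow> nat \<Rightarrow> real)"

record 'm smooth_structure =
  mdim :: nat
  atlas :: "'m chart set"

text \<open>The underlying set of a manifold is a whole type; the Hausdorff property and second
  countability are provided by its type classes. The atlas need not be maximal.\<close>

definition smooth_manifold ::
    "'m::{t2_space, second_countable_topology} smooth_structure \<Rightarrow> bool" where
  "smooth_manifold M \<longleftrightarrow>
     (\<Union>(U, \<phi>)\<in>atlas M. U) = UNIV \<and>
     (\<forall>(U, \<phi>)\<in>atlas M. open U \<and> openin (Euclidean_space (mdim M)) (\<phi> ` U) \<and>
        homeomorphism U (\<phi> ` U) \<phi> (inv_into U \<phi>)) \<and>
     (\<forall>(U, \<phi>)\<in>atlas M. \<forall>(V, \<psi>)\<in>atlas M. \<forall>j<mdim M.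
        smooth_on (mdim M) (\<phi> ` (U \<inter> V)) (\<lambda>x. \<psi> (inv_into U \<phi> x) j))"

text \<open>Smoothness of \<open>f\<close> on the open subset \<open>W\<close> of \<open>M\<close>.\<close>

definition smooth_map_on ::
    "'m::topological_space set \<Rightarrow> 'm smooth_structure \<Rightarrow> 'n::topological_space smooth_structure
      \<Rightarrow> ('m \<Rightarrow> 'n) \<Rightarrow> bool" where
  "smooth_map_on W M N f \<longleftrightarrow> continuous_on W f \<and>
     (\<forall>(U, \<phi>)\<in>atlas M. \<forall>(V, \<psi>)\<in>atlas N. \<forall>j<mdim N.
        smooth_on (mdim M) (\<phi> ` (W \<inter> U \<inter> f -` V)) (\<lambda>x. \<psi> (f (inv_into U \<phi> x)) j))"

abbreviation smooth_map ::
    "'m::topological_space smooth_structure \<Rightarrow> 'n::topological_space smooth_structure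
      \<Rightarrow> ('m \<Rightarrow> 'n) \<Rightarrow> bool" where
  "smooth_map \<equiv> smooth_map_on UNIV"

definition diffeomorphism_on ::
    "'m::topological_space set \<Rightarrow> 'n::topological_space set \<Rightarrow> 'm smooth_structure
      \<Rightarrow> 'n smooth_structure \<Rightarrow> ('m \<Rightarrow> 'n) \<Rightarrow> bool" where
  "diffeomorphism_on W W' M N f \<longleftrightarrow> open W \<and> open W' \<and> bij_betw f W W' \<and>
     smooth_map_on W M N f \<and> smooth_map_on W' N M (inv_into W f)"

definition prod_structure ::
    "'m smooth_structure \<Rightarrow> 'n smooth_structure \<Rightarrow> ('m \<times> 'n) smooth_structure" where
  "prod_structure M N = \<lparr>mdim = mdim M + mdim N,
     atlas = {(U \<times> V, \<lambda>(x, y) i. if i < mdim M then \<phi> x i else \<psi> y (i - mdim M)) | U \<phi> V \<psi>.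
                (U, \<phi>) \<in> atlas M \<and> (V, \<psi>) \<in> atlas N}\<rparr>"

definition smooth_functions :: "'m smooth_structure \<Rightarrow> ('m \<Rightarrow> real) set" where
  "smooth_functions M = {f. \<forall>(U, \<phi>)\<in>atlas M. smooth_on (mdim M) (\<phi> ` U) (f \<circ> inv_into U \<phi>)}"

text \<open>Smooth maps from an open subset \<open>U\<close> of \<open>Euclidean_space p\<close> into a manifold.\<close>

definition smooth_into ::
    "'m::topological_space smooth_structure \<Rightarrow> nat \<Rightarrow> (nat \<Rightarrow> real) set
      \<Rightarrow> ((nat \<Rightarrow> real) \<Rightarrow> 'm) \<Rightarrow> bool" where
  "smooth_into M p U c \<longleftrightarrow> openin (Euclidean_space p) U \<and> continuous_on U c \<and>
     (\<forall>(V, \<psi>)\<in>atlas M. \<forall>j<mdim M. smooth_on p (U \<inter> c -` V) (\<lambda>x. \<psi> (c x) j))"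

definition smooth_curve :: "'m::topological_space smooth_structure \<Rightarrow> (real \<Rightarrow> 'm) \<Rightarrow> bool" where
  "smooth_curve M c \<longleftrightarrow> smooth_into M 1 (topspace (Euclidean_space 1)) (\<lambda>x. c (x 0))"


section \<open>Tangent vectors, vector fields, differential forms\<close>

text \<open>Tangent vectors are derivations of the algebra of smooth functions. To make them unique
  as HOL functions they are set to \<open>0\<close> on functions which are not smooth.\<close>

type_synonym 'm tangent = "('m \<Rightarrow> real) \<Rightarrow> real"

definition tangent_space :: "'m smooth_structure \<Rightarrow> 'm \<Rightarrow> 'm tangent set" where
  "tangent_space M x = {v.
     (\<forall>f. f \<notin> smooth_functions M \<longrightarrow> v f = 0) \<and>
     (\<forall>f\<in>smooth_functions M. \<forall>a. v (\<lambda>y. a * f y) = a * v f) \<and>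
     (\<forall>f\<in>smooth_functions M. \<forall>g\<in>smooth_functions M.
        v (\<lambda>y. f y + g y) = v f + v g \<and> v (\<lambda>y. f y * g y) = f x * v g + g x * v f)}"

definition push_forward ::
    "'n smooth_structure \<Rightarrow> ('m \<Rightarrow> 'n) \<Rightarrow> 'm tangent \<Rightarrow> 'n tangent" where
  "push_forward N F v = (\<lambda>f. if f \<in> smooth_functions N then v (f \<circ> F) else 0)"

definition velocity :: "'m smooth_structure \<Rightarrow> (real \<Rightarrow> 'm) \<Rightarrow> real \<Rightarrow> 'm tangent" where
  "velocity M c t = (\<lambda>f. if f \<in> smooth_functions M then deriv (f \<circ> c) t else 0)"

definition smooth_vector_field :: "'m smooth_structure \<Rightarrow> ('m \<Rightarrow> 'm tangent) \<Rightarrow> bool" where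
  "smooth_vector_field M X \<longleftrightarrow> (\<forall>x. X x \<in> tangent_space M x) \<and>
     (\<forall>f\<in>smooth_functions M. (\<lambda>x. X x f) \<in> smooth_functions M)"

definition lie_bracket ::
    "'m smooth_structure \<Rightarrow> ('m \<Rightarrow> 'm tangent) \<Rightarrow> ('m \<Rightarrow> 'm tangent) \<Rightarrow> 'm \<Rightarrow> 'm tangent" where
  "lie_bracket M X Y x = (\<lambda>f. if f \<in> smooth_functions M
     then X x (\<lambda>y. Y y f) - Y x (\<lambda>y. X y f) else 0)"

text \<open>A 1-form with values in the vector space \<open>'g\<close> is a family of maps on the tangent spaces.
  Smoothness of maps into a finite-dimensional \<open>'g\<close> is tested with the linear functionals.\<close>

type_synonym ('m, 'g) form1 = "'m \<Rightarrow> 'm tangent \<Rightarrow> 'g"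

definition smooth_form1 ::
    "'m smooth_structure \<Rightarrow> ('m, 'g::real_vector) form1 \<Rightarrow> bool" where
  "smooth_form1 M \<omega> \<longleftrightarrow>
     (\<forall>x. \<forall>v\<in>tangent_space M x. \<forall>w\<in>tangent_space M x. \<omega> x (\<lambda>f. v f + w f) = \<omega> x v + \<omega> x w) \<and>
     (\<forall>x. \<forall>v\<in>tangent_space M x. \<forall>a. \<omega> x (\<lambda>f. a * v f) = a *\<^sub>R \<omega> x v) \<and>
     (\<forall>X. smooth_vector_field M X \<longrightarrow>
        (\<forall>l :: 'g \<Rightarrow> real. linear l \<longrightarrow> (\<lambda>x. l (\<omega> x (X x))) \<in> smooth_functions M))"

definition exterior_deriv ::
    "'m smooth_structure \<Rightarrow> ('m, real) form1 \<Rightarrow> ('m \<Rightarrow> 'm tangent) \<Rightarrow> ('m \<Rightarrow> 'm tangent)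
      \<Rightarrow> 'm \<Rightarrow> real" where
  "exterior_deriv M \<alpha> X Y x =
     X x (\<lambda>y. \<alpha> y (Y y)) - Y x (\<lambda>y. \<alpha> y (X y)) - \<alpha> x (lie_bracket M X Y x)"

definition bracket_forms ::
    "('g \<Rightarrow> 'g \<Rightarrow> 'g::real_vector) \<Rightarrow> ('m, 'g) form1 \<Rightarrow> ('m, 'g) form1
      \<Rightarrow> 'm \<Rightarrow> 'm tangent \<Rightarrow> 'm tangent \<Rightarrow> 'g" where
  "bracket_forms br \<alpha> \<beta> x v w = br (\<alpha> x v) (\<beta> x w) - br (\<alpha> x w) (\<beta> x v)"

definition pullback ::
    "'n smooth_structure \<Rightarrow> ('m \<Rightarrow> 'n) \<Rightarrow> ('n, 'g) form1 \<Rightarrow> ('m, 'g) form1" where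
  "pullback N F \<omega> x v = \<omega> (F x) (push_forward N F v)"


section \<open>Lie algebras, Lie groups, Lie foliations\<close>

definition fin_dim_lie_algebra :: "('g \<Rightarrow> 'g \<Rightarrow> 'g::real_vector) \<Rightarrow> bool" where
  "fin_dim_lie_algebra br \<longleftrightarrow> (\<exists>B::'g set. finite B \<and> span B = UNIV) \<and>
     bilinear br \<and> (\<forall>a. br a a = 0) \<and>
     (\<forall>a b c. br a (br b c) + br b (br c a) + br c (br a b) = 0)"

text \<open>The equation \<open>d\<omega> = -1/2 [\<omega>, \<omega>]\<close> between 2-forms with values in the Lie algebra is an
  equation of real 2-forms after composition with each linear functional \<open>l\<close>.\<close>

definition lie_foliation ::
    "'m smooth_structure \<Rightarrow> ('g \<Rightarrow> 'g \<Rightarrow> 'g::real_vector) \<Rightarrow> ('m, 'g) form1 \<Rightarrow> bool" where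
  "lie_foliation M br \<omega> \<longleftrightarrow> smooth_form1 M \<omega> \<and>
     (\<forall>x. \<omega> x ` tangent_space M x = UNIV) \<and>
     (\<forall>X Y. smooth_vector_field M X \<longrightarrow> smooth_vector_field M Y \<longrightarrow>
        (\<forall>l :: 'g \<Rightarrow> real. linear l \<longrightarrow> (\<forall>x.
           exterior_deriv M (\<lambda>y v. l (\<omega> y v)) X Y x =
           l (- (1/2) *\<^sub>R bracket_forms br \<omega> \<omega> x (X x) (Y x)))))"

text \<open>The leaf through \<open>x\<close> of the foliation defined by the kernel of \<open>\<omega>\<close>: the points which can be
  reached from \<open>x\<close> along piecewise smooth curves tangent to that kernel.\<close>

definition tangent_arc ::
    "'m::topological_space smooth_structure \<Rightarrow> ('m, 'g::zero) form1 \<Rightarrow> 'm \<Rightarrow> 'm \<Rightarrow> bool" where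
  "tangent_arc M \<omega> x y \<longleftrightarrow> (\<exists>c. smooth_curve M c \<and> c 0 = x \<and> c 1 = y \<and>
     (\<forall>t. \<omega> (c t) (velocity M c t) = 0))"

definition leaf ::
    "'m::topological_space smooth_structure \<Rightarrow> ('m, 'g::zero) form1 \<Rightarrow> 'm \<Rightarrow> 'm set" where
  "leaf M \<omega> x = {y. rtranclp (tangent_arc M \<omega>) x y}"

definition lie_group ::
    "'a::{t2_space, second_countable_topology} smooth_structure \<Rightarrow> 'a monoid \<Rightarrow> bool" where
  "lie_group N G \<longleftrightarrow> smooth_manifold N \<and> group G \<and> carrier G = UNIV \<and>
     smooth_map (prod_structure N N) N (\<lambda>(x, y). x \<otimes>\<^bsub>G\<^esub> y) \<and> smooth_map N N (m_inv G)"

definition left_invariant_fields ::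
    "'a smooth_structure \<Rightarrow> 'a monoid \<Rightarrow> ('a \<Rightarrow> 'a tangent) set" where
  "left_invariant_fields N G = {X. smooth_vector_field N X \<and>
     (\<forall>g x. X (g \<otimes>\<^bsub>G\<^esub> x) = push_forward N (\<lambda>y. g \<otimes>\<^bsub>G\<^esub> y) (X x))}"

text \<open>The Lie algebra of \<open>G\<close> is (isomorphic to) the Lie algebra with bracket \<open>br\<close>.\<close>

definition has_lie_algebra ::
    "'a smooth_structure \<Rightarrow> 'a monoid \<Rightarrow> ('g \<Rightarrow> 'g \<Rightarrow> 'g::real_vector) \<Rightarrow> bool" where
  "has_lie_algebra N G br \<longleftrightarrow> (\<exists>\<Theta> :: 'g \<Rightarrow> 'a \<Rightarrow> 'a tangent.
     bij_betw \<Theta> UNIV (left_invariant_fields N G) \<and>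
     (\<forall>a b. \<Theta> (a + b) = (\<lambda>x f. \<Theta> a x f + \<Theta> b x f)) \<and>
     (\<forall>r a. \<Theta> (r *\<^sub>R a) = (\<lambda>x f. r * \<Theta> a x f)) \<and>
     (\<forall>a b. \<Theta> (br a b) = lie_bracket N (\<Theta> a) (\<Theta> b)))"


section \<open>Fundamental group, coverings, bundles, developments\<close>

definition homotopy_class :: "(real \<Rightarrow> 'm::topological_space) \<Rightarrow> (real \<Rightarrow> 'm) set" where
  "homotopy_class \<gamma> = {\<delta>. homotopic_paths UNIV \<gamma> \<delta>}"

definition loops_at :: "'m::topological_space \<Rightarrow> (real \<Rightarrow> 'm) set" where
  "loops_at x = {\<gamma>. path \<gamma> \<and> pathstart \<gamma> = x \<and> pathfinish \<gamma> = x}"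

definition fundamental_group :: "'m::topological_space \<Rightarrow> (real \<Rightarrow> 'm) set monoid" where
  "fundamental_group x = \<lparr>carrier = homotopy_class ` loops_at x,
     mult = (\<lambda>A B. {\<delta>. \<exists>\<alpha>\<in>A. \<exists>\<beta>\<in>B. homotopic_paths UNIV (\<alpha> +++ \<beta>) \<delta>}),
     one = homotopy_class (\<lambda>_. x)\<rparr>"

definition deck_transformations :: "('c::topological_space \<Rightarrow> 'm) \<Rightarrow> ('c \<Rightarrow> 'c) set" where
  "deck_transformations p = {\<tau>. (\<exists>\<tau>'. homeomorphism UNIV UNIV \<tau> \<tau>') \<and> p \<circ> \<tau> = p}"

definition regular_covering ::
    "'c::topological_space smooth_structure \<Rightarrow> 'm::topological_space smooth_structure
      \<Rightarrow> ('c \<Rightarrow> 'm) \<Rightarrow> bool" where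
  "regular_covering Mt M p \<longleftrightarrow> connected (UNIV :: 'c set) \<and> covering_space UNIV p UNIV \<and>
     (\<forall>x. \<exists>W. x \<in> W \<and> diffeomorphism_on W (p ` W) Mt M p) \<and>
     (\<forall>x y. p x = p y \<longrightarrow> (\<exists>\<tau>\<in>deck_transformations p. \<tau> x = y))"

definition locally_trivial_bundle ::
    "'c::topological_space smooth_structure \<Rightarrow> 'a::topological_space smooth_structure
      \<Rightarrow> 'f::topological_space smooth_structure \<Rightarrow> ('c \<Rightarrow> 'a) \<Rightarrow> bool" where
  "locally_trivial_bundle E N F D \<longleftrightarrow> smooth_map E N D \<and>
     (\<forall>g. \<exists>V \<theta>. g \<in> V \<and> open V \<and>
        diffeomorphism_on (D -` V) (V \<times> (UNIV :: 'f set)) E (prod_structure N F) (\<lambda>x. (D x, \<theta> x)))"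

text \<open>
  A development of the foliation of \<open>M\<close> defined by \<open>\<omega>\<close>: a regular covering \<open>p\<close> of \<open>M\<close>, a locally
  trivial bundle \<open>D\<close> with typical fibre \<open>F\<close> over the group, whose fibres are the leaves of the
  lifted foliation, and a holonomy morphism \<open>h\<close>. The base points \<open>x0\<close> and \<open>xt0\<close> identify the
  fundamental group of the total space with a subgroup of that of \<open>M\<close>, and make the fundamental
  group of \<open>M\<close> act from the left by deck transformations: the class of \<open>p \<circ> \<gamma>\<close>, for a path \<open>\<gamma>\<close>
  issued from \<open>xt0\<close>, acts as the deck transformation which maps \<open>xt0\<close> to the endpoint of \<open>\<gamma>\<close>.
\<close>

definition development ::
    "'m::{t2_space, second_countable_topology} smooth_structure \<Rightarrow> ('m, 'g::real_vector) form1
      \<Rightarrow> 'a::{t2_space, second_countable_topology} smooth_structure \<Rightarrow> 'a monoid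
      \<Rightarrow> 'c::{t2_space, second_countable_topology} smooth_structure \<Rightarrow> ('c \<Rightarrow> 'm)
      \<Rightarrow> 'f::{t2_space, second_countable_topology} smooth_structure \<Rightarrow> ('c \<Rightarrow> 'a)
      \<Rightarrow> 'm \<Rightarrow> 'c \<Rightarrow> ((real \<Rightarrow> 'm) set \<Rightarrow> 'a) \<Rightarrow> bool" where
  "development M \<omega> N G Mt p F D x0 xt0 h \<longleftrightarrow>
     smooth_manifold Mt \<and> regular_covering Mt M p \<and> p xt0 = x0 \<and>
     smooth_manifold F \<and> locally_trivial_bundle Mt N F D \<and>
     (\<forall>x. leaf Mt (pullback M p \<omega>) x = D -` {D x}) \<and>
     h \<in> hom (fundamental_group x0) G \<and>
     kernel (fundamental_group x0) G h = {homotopy_class (p \<circ> \<gamma>) | \<gamma>. \<gamma> \<in> loops_at xt0} \<and>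
     (\<forall>\<gamma> \<tau>. path \<gamma> \<longrightarrow> pathstart \<gamma> = xt0 \<longrightarrow> p \<circ> \<gamma> \<in> loops_at x0 \<longrightarrow>
        \<tau> \<in> deck_transformations p \<longrightarrow> \<tau> xt0 = pathfinish \<gamma> \<longrightarrow>
        (\<forall>x. D (\<tau> x) = h (homotopy_class (p \<circ> \<gamma>)) \<otimes>\<^bsub>G\<^esub> D x))"

abbreviation holonomy_group :: "'m::topological_space \<Rightarrow> ((real \<Rightarrow> 'm) set \<Rightarrow> 'a) \<Rightarrow> 'a set" where
  "holonomy_group x0 h \<equiv> h ` carrier (fundamental_group x0)"


section \<open>Quotient diffeologies\<close>

text \<open>The set of plots: a plot is given by the dimension \<open>p\<close>, its domain, an open subset \<open>U\<close> of
  \<open>Euclidean_space p\<close>, and a map of which only the values on \<open>U\<close> matter.\<close>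

type_synonym 'q diffeology = "nat \<Rightarrow> (nat \<Rightarrow> real) set \<Rightarrow> ((nat \<Rightarrow> real) \<Rightarrow> 'q) \<Rightarrow> bool"

definition quotient_diffeology ::
    "'m::topological_space smooth_structure \<Rightarrow> ('m \<Rightarrow> 'q) \<Rightarrow> 'q diffeology" where
  "quotient_diffeology M \<pi> p U c \<longleftrightarrow> openin (Euclidean_space p) U \<and>
     (\<forall>u\<in>U. \<exists>V s. u \<in> V \<and> V \<subseteq> U \<and> smooth_into M p V s \<and> (\<forall>v\<in>V. \<pi> (s v) = c v))"

definition differentiable_map ::
    "'q diffeology \<Rightarrow> 'r diffeology \<Rightarrow> ('q \<Rightarrow> 'r) \<Rightarrow> bool" where
  "differentiable_map P Q f \<longleftrightarrow> (\<forall>p U c. P p U c \<longrightarrow> Q p U (f \<circ> c))"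

definition Diff_group :: "'q set \<Rightarrow> 'q diffeology \<Rightarrow> ('q \<Rightarrow> 'q) monoid" where
  "Diff_group X P = BijGroup X
     \<lparr>carrier := {f \<in> Bij X. differentiable_map P P f \<and> differentiable_map P P (inv_into X f)}\<rparr>"

definition Diff_leaf_space ::
    "'m::topological_space smooth_structure \<Rightarrow> ('m, 'g::zero) form1
      \<Rightarrow> ('m set \<Rightarrow> 'm set) monoid" where
  "Diff_leaf_space M \<omega> = Diff_group (range (leaf M \<omega>)) (quotient_diffeology M (leaf M \<omega>))"

text \<open>The points of \<open>G/\<Gamma>\<close> are the left cosets \<open>g\<Gamma>\<close>.\<close>

definition Diff_coset_space ::
    "'a::topological_space smooth_structure \<Rightarrow> 'a monoid \<Rightarrow> 'a set \<Rightarrow> ('a set \<Rightarrow> 'a set) monoid" where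
  "Diff_coset_space N G \<Gamma> =
     Diff_group (lcosets\<^bsub>G\<^esub> \<Gamma>) (quotient_diffeology N (\<lambda>g. g <#\<^bsub>G\<^esub> \<Gamma>))"

end

theory Submission
  imports Defs
begin

text \<open>
  Deck transformations act on \<open>G\<close> through \<open>D\<close> as the left translations by the elements of \<open>\<Gamma>\<close>, and
  the leaf of \<open>M\<close> through \<open>p y\<close> is \<open>p ` D -` {D y}\<close>, since tangent curves lift along \<open>p\<close>. Hence
  \<open>D\<close> identifies \<open>M/\<F>\<close> with the set of right cosets \<open>\<Gamma>g\<close>, and inversion turns these into the
  left cosets \<open>g\<inverse>\<Gamma>\<close>. The resulting bijection carries plots to plots in both directions, because
  \<open>p\<close> is a local diffeomorphism and \<open>D\<close> has smooth local sections. Conjugation by it is the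
  isomorphism.
\<close>

section \<open>The chain rule for functions of class $C^k$\<close>

text \<open>Smoothness means iterated partial derivatives on \<open>nat => real\<close>, so
  composing plots with smooth maps rests on a chain rule, which is derived from the one-variable
  mean value theorem. The total space \<open>Mt\<close> mediates between the two quotients: a point
  \<open>y\<close> of it names both the leaf through \<open>p y\<close> and the coset of the inverse
  of \<open>D y\<close>, and the deck transformations account for all coincidences on either side.
  The hypothesis \<open>development\<close> states equivariance for a deck transformation that comes
  with a path from \<open>xt0\<close> to the image of \<open>xt0\<close>. Passing between \<Gamma>
  and the deck transformations therefore takes paths in \<open>Mt\<close>, which is connected and
  locally Euclidean, and lifts of loops of \<open>M\<close>, whose endpoints regularity turns into
  deck transformations. Leaves consist of the points reached by chains of arcs of smooth curves, and
  these curves are defined on the whole line; so it is curves on the whole line that have to be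
  lifted, with control of their velocities.\<close>

lemma openin_Euclidean_space_iff:
  "openin (Euclidean_space n) U \<longleftrightarrow> openin (top_of_set {x. \<forall>i\<ge>n. x i = 0}) U"
  by (simp add: Euclidean_space_def euclidean_product_topology)

lemma openin_Euclidean_space_zero:
  "openin (Euclidean_space n) U \<Longrightarrow> x \<in> U \<Longrightarrow> n \<le> i \<Longrightarrow> x i = 0"
  using openin_subset topspace_Euclidean_space by blast

text \<open>A basic product neighbourhood constrains a point of the subspace only in its first
  \<open>n\<close> coordinates, since the others agree with those of \<open>a\<close>, which are 0.
  So finitely many radii matter.\<close>

lemma openin_Euclidean_space_box:
  assumes "openin (Euclidean_space n) U" "a \<in> U"
  obtains e where "e > 0" "\<And>y. (\<And>i. n \<le> i \<Longrightarrow> y i = 0) \<Longrightarrow> (\<And>i. i < n \<Longrightarrow> \<bar>y i - a i\<bar> < e) \<Longrightarrow> y \<in> U"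
proof -
  have a0: "a i = 0" if "n \<le> i" for i
    using openin_Euclidean_space_zero[OF assms that] .
  obtain T where T: "openin (powertop_real UNIV) T" "U = T \<inter> {x. \<forall>i\<ge>n. x i = 0}"
    using assms(1) by (auto simp: Euclidean_space_def openin_subtopology)
  then obtain X where X: "a \<in> (\<Pi>\<^sub>E i\<in>UNIV. X i)" "\<And>i. open (X i)" "(\<Pi>\<^sub>E i\<in>UNIV. X i) \<subseteq> T"
    using product_topology_open_contains_basis[OF T(1), of a] assms(2) by auto
  have "\<exists>e>0. \<forall>s. \<bar>s - a i\<bar> < e \<longrightarrow> s \<in> X i" for i
    using X(1) X(2)[of i] unfolding open_dist by (auto simp: dist_real_def PiE_iff)
  then obtain e where e: "\<And>i. e i > 0" "\<And>i s. \<bar>s - a i\<bar> < e i \<Longrightarrow> s \<in> X i"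
    by metis
  show thesis
  \<comment> \<open>The inserted 1 keeps the set nonempty when \<open>n = 0\<close>.\<close>
  proof (rule that[of "Min (insert 1 (e ` {..<n}))"])
    show "Min (insert 1 (e ` {..<n})) > 0" using e(1) by auto
    fix y assume y: "\<And>i. n \<le> i \<Longrightarrow> y i = 0" "\<And>i. i < n \<Longrightarrow> \<bar>y i - a i\<bar> < Min (insert 1 (e ` {..<n}))"
    have "y i \<in> X i" for i
    proof (cases "i < n")
      case True
      then show ?thesis using y(2)[OF True] by (intro e(2)) auto
    next
      case False
      then have "y i = a i" using y(1) a0 by simp
      then show ?thesis using X(1) by (simp add: PiE_iff)
    qed
    then show "y \<in> U" using X(3) y(1) unfolding T(2) by auto
  qed
qed

lemma openin_Euclidean_space_update:
  assumes "openin (Euclidean_space n) U" "a \<in> U" "i < n"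
  shows "\<forall>\<^sub>F t in nhds (a i). a(i := t) \<in> U"
proof -
  obtain e where e: "e > 0" "\<And>y. (\<And>i. n \<le> i \<Longrightarrow> y i = 0) \<Longrightarrow> (\<And>i. i < n \<Longrightarrow> \<bar>y i - a i\<bar> < e) \<Longrightarrow> y \<in> U"
    using openin_Euclidean_space_box[OF assms(1,2)] by metis
  have "a(i := t) \<in> U" if "dist t (a i) < e" for t
    using that assms(3) e(1) openin_Euclidean_space_zero[OF assms(1,2)]
    by (intro e(2)) (auto simp: dist_real_def)
  then show ?thesis
    unfolding eventually_nhds_metric using e(1) by blast
qed

section \<open>Restriction, locality and algebra of functions of class C^k\<close>

lemma C_diff_imp_continuous_on: "C_diff k n U f \<Longrightarrow> continuous_on U f"
  by (cases k) auto

lemma C_diff_SucI: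
  assumes "continuous_on U f"
    and "\<And>i x. i < n \<Longrightarrow> x \<in> U \<Longrightarrow> ((\<lambda>t. f (x(i := t))) has_real_derivative df i x) (at (x i))"
    and "\<And>i. i < n \<Longrightarrow> C_diff k n U (df i)"
  shows "C_diff (Suc k) n U f"
  unfolding C_diff.simps
proof (intro conjI allI impI)
  fix i assume "i < n"
  then show "\<exists>g. (\<forall>x\<in>U. ((\<lambda>t. f (x(i := t))) has_real_derivative g x) (at (x i))) \<and> C_diff k n U g"
    using assms(2,3) by (intro exI[of _ "df i"]) simp
qed (fact assms(1))

text \<open>The definition hides each partial derivative behind its own existential quantifier;
  gathering them into one family \<open>df\<close> lets later proofs compute with them.\<close>

lemma C_diff_SucE:
  assumes "C_diff (Suc k) n U f"
  obtains df where "\<And>i x. i < n \<Longrightarrow> x \<in> U \<Longrightarrow> ((\<lambda>t. f (x(i := t))) has_real_derivative df i x) (at (x i))"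
    and "\<And>i. i < n \<Longrightarrow> C_diff k n U (df i)"
proof -
  have "\<forall>i. \<exists>g. i < n \<longrightarrow> (\<forall>x\<in>U. ((\<lambda>t. f (x(i := t))) has_real_derivative g x) (at (x i))) \<and> C_diff k n U g"
    using assms by auto
  then obtain df where "\<forall>i. i < n \<longrightarrow>
      (\<forall>x\<in>U. ((\<lambda>t. f (x(i := t))) has_real_derivative df i x) (at (x i))) \<and> C_diff k n U (df i)"
    using choice[of "\<lambda>i g. i < n \<longrightarrow> (\<forall>x\<in>U. ((\<lambda>t. f (x(i := t))) has_real_derivative g x) (at (x i))) \<and> C_diff k n U g"]
    by blast
  then show thesis using that[of df] by blast
qed

lemma C_diff_subset: "C_diff k n U f \<Longrightarrow> V \<subseteq> U \<Longrightarrow> C_diff k n V f"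
proof (induction k arbitrary: f)
  case (Suc k)
  obtain df where df: "\<And>i x. i < n \<Longrightarrow> x \<in> U \<Longrightarrow> ((\<lambda>t. f (x(i := t))) has_real_derivative df i x) (at (x i))"
    "\<And>i. i < n \<Longrightarrow> C_diff k n U (df i)"
    using C_diff_SucE[OF Suc.prems(1)] by blast
  show ?case
  proof (rule C_diff_SucI)
    show "continuous_on V f"
      using Suc.prems C_diff_imp_continuous_on continuous_on_subset by blast
    show "((\<lambda>t. f (x(i := t))) has_real_derivative df i x) (at (x i))" if "i < n" "x \<in> V" for i x
      using df(1) that Suc.prems(2) by blast
    show "C_diff k n V (df i)" if "i < n" for i
      using Suc.IH[OF df(2)[OF that] Suc.prems(2)] .
  qed
qed (auto intro: continuous_on_subset)

lemma C_diff_Suc_imp: "C_diff (Suc k) n U f \<Longrightarrow> C_diff k n U f"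
proof (induction k arbitrary: f)
  case (Suc k)
  obtain df where df: "\<And>i x. i < n \<Longrightarrow> x \<in> U \<Longrightarrow> ((\<lambda>t. f (x(i := t))) has_real_derivative df i x) (at (x i))"
    "\<And>i. i < n \<Longrightarrow> C_diff (Suc k) n U (df i)"
    using C_diff_SucE[OF Suc.prems] by blast
  show ?case
    using C_diff_imp_continuous_on[OF Suc.prems] df(1) Suc.IH[OF df(2)] by (rule C_diff_SucI)
qed simp

text \<open>A partial derivative at \<open>x\<close> looks at a small coordinate segment about
  \<open>x\<close>. Openness keeps such a segment inside \<open>U\<close>, so the partial
  derivatives of \<open>f\<close> serve for \<open>g\<close> unchanged and no induction is called
  for.\<close>

lemma C_diff_cong:
  assumes U: "openin (Euclidean_space n) U" and eq: "\<And>x. x \<in> U \<Longrightarrow> f x = g x" and f: "C_diff k n U f"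
  shows "C_diff k n U g"
proof (cases k)
  case 0
  then show ?thesis
    using continuous_on_eq[OF C_diff_imp_continuous_on[OF f] eq] by simp
next
  case (Suc m)
  note f' = f[unfolded Suc]
  obtain df where df: "\<And>i x. i < n \<Longrightarrow> x \<in> U \<Longrightarrow> ((\<lambda>t. f (x(i := t))) has_real_derivative df i x) (at (x i))"
    "\<And>i. i < n \<Longrightarrow> C_diff m n U (df i)"
    using C_diff_SucE[OF f'] by blast
  show ?thesis
    unfolding Suc
  proof (rule C_diff_SucI)
    show "continuous_on U g"
      using continuous_on_eq[OF C_diff_imp_continuous_on[OF f] eq] .
    show "((\<lambda>t. g (x(i := t))) has_real_derivative df i x) (at (x i))" if "i < n" "x \<in> U" for x i
    proof -
      have "\<forall>\<^sub>F t in nhds (x i). f (x(i := t)) = g (x(i := t))"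
        using openin_Euclidean_space_update[OF U that(2,1)] by eventually_elim (rule eq)
      from DERIV_cong_ev[OF refl this refl] show ?thesis
        using df(1)[OF that] by simp
    qed
  qed (rule df(2))
qed

lemma continuous_on_local:
  assumes "\<And>x. x \<in> U \<Longrightarrow> \<exists>V. openin (top_of_set U) V \<and> x \<in> V \<and> continuous_on V f"
  shows "continuous_on U f"
  unfolding continuous_on_def
proof
  fix x assume "x \<in> U"
  then obtain T where T: "open T" "x \<in> U \<inter> T" "continuous_on (U \<inter> T) f"
    using assms[of x] by (auto simp: openin_open)
  then have "(f \<longlongrightarrow> f x) (at x within U \<inter> T)"
    by (simp add: continuous_on_def)
  moreover have "at x within U \<inter> T = at x within U"
    using T by (intro at_within_nhd[of x T]) auto
  ultimately show "(f \<longlongrightarrow> f x) (at x within U)" by simp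
qed

text \<open>Continuity into the product is coordinatewise, and membership in \<open>V\<close> forces
  the coordinates from \<open>n\<close> on to vanish.\<close>

lemma continuous_on_Euclidean_space:
  assumes V: "openin (Euclidean_space n) V" and fV: "\<And>x. x \<in> U \<Longrightarrow> f x \<in> V"
    and cont: "\<And>j. j < n \<Longrightarrow> continuous_on U (\<lambda>x. f x j)"
  shows "continuous_on U f"
proof (rule continuous_on_coordinatewise_then_product)
  fix j show "continuous_on U (\<lambda>x. f x j)"
  proof (cases "j < n")
    case False
    then have "f x j = 0" if "x \<in> U" for x
      using openin_Euclidean_space_zero[OF V fV[OF that]] by simp
    then show ?thesis using continuous_on_cong[of U U "\<lambda>x. f x j" "\<lambda>x. 0"] by simp
  qed (rule cont)
qed

lemma openin_Euclidean_space_imp_subset: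
  "openin (Euclidean_space n) V \<Longrightarrow> V \<subseteq> U \<Longrightarrow> openin (Euclidean_space n) U \<Longrightarrow> openin (top_of_set U) V"
  unfolding openin_Euclidean_space_iff by (blast intro: openin_subset_trans dest: openin_imp_subset)

text \<open>The neighbourhoods come with unrelated partial derivatives, which have to be glued. By
  uniqueness of derivatives \<open>deriv\<close> agrees with each of them where it is defined, so it
  is a global choice to which the induction hypothesis applies.\<close>

lemma C_diff_local:
  assumes U: "openin (Euclidean_space n) U"
    and loc: "\<And>x. x \<in> U \<Longrightarrow> \<exists>V. openin (Euclidean_space n) V \<and> x \<in> V \<and> V \<subseteq> U \<and> C_diff k n V f"
  shows "C_diff k n U f"
  using loc
proof (induction k arbitrary: f)
  case (0 f)
  have "continuous_on U f"
  proof (rule continuous_on_local)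
    fix x assume "x \<in> U"
    with 0 obtain V where V: "openin (Euclidean_space n) V" "x \<in> V" "V \<subseteq> U" "continuous_on V f"
      by auto
    show "\<exists>V. openin (top_of_set U) V \<and> x \<in> V \<and> continuous_on V f"
      using V(2,4) openin_Euclidean_space_imp_subset[OF V(1,3) U] by auto
  qed
  then show ?case by simp
next
  case (Suc k)
  show ?case
  proof (rule C_diff_SucI)
    let ?g = "\<lambda>i x. deriv (\<lambda>t. f (x(i := t))) (x i)"
    show "continuous_on U f"
    proof (rule continuous_on_local)
      fix x assume "x \<in> U"
      from Suc.prems[OF this] obtain V where V: "openin (Euclidean_space n) V" "x \<in> V" "V \<subseteq> U" "C_diff (Suc k) n V f"
        by blast
      show "\<exists>V. openin (top_of_set U) V \<and> x \<in> V \<and> continuous_on V f"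
        using V(2) openin_Euclidean_space_imp_subset[OF V(1,3) U] C_diff_imp_continuous_on[OF V(4)] by auto
    qed
    have ex: "\<exists>V. openin (Euclidean_space n) V \<and> x \<in> V \<and> V \<subseteq> U \<and>
        (\<forall>x\<in>V. ((\<lambda>t. f (x(i := t))) has_real_derivative ?g i x) (at (x i))) \<and> C_diff k n V (?g i)"
      if "i < n" and x: "x \<in> U" for i x
    proof -
      from Suc.prems[OF x] obtain V where V: "openin (Euclidean_space n) V" "x \<in> V" "V \<subseteq> U" "C_diff (Suc k) n V f"
        by blast
      obtain g where g: "\<And>i x. i < n \<Longrightarrow> x \<in> V \<Longrightarrow> ((\<lambda>t. f (x(i := t))) has_real_derivative g i x) (at (x i))"
        "\<And>i. i < n \<Longrightarrow> C_diff k n V (g i)"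
        using C_diff_SucE[OF V(4)] by blast
      have eq: "g i y = ?g i y" if "y \<in> V" for y
        using DERIV_imp_deriv[OF g(1)[OF \<open>i < n\<close> that]] by (rule sym)
      have "((\<lambda>t. f (y(i := t))) has_real_derivative ?g i y) (at (y i))" if "y \<in> V" for y
        using g(1)[OF \<open>i < n\<close> that] unfolding eq[OF that] .
      then show ?thesis using V(1-3) C_diff_cong[OF V(1) eq g(2)[OF \<open>i < n\<close>]] by (intro exI[of _ V]) simp
    qed
    show "((\<lambda>t. f (x(i := t))) has_real_derivative ?g i x) (at (x i))" if "i < n" "x \<in> U" for i x
      using ex[OF that] by auto
    show "C_diff k n U (?g i)" if "i < n" for i
      by (rule Suc.IH) (use ex[OF that] in blast)
  qed
qed

lemma C_diff_const: "C_diff k n U (\<lambda>x. c)"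
proof (induction k arbitrary: c)
  case (Suc k)
  show ?case by (rule C_diff_SucI[where df = "\<lambda>i x. 0"]) (use Suc in auto)
qed simp

lemma C_diff_add:
  "C_diff k n U f \<Longrightarrow> C_diff k n U g \<Longrightarrow> C_diff k n U (\<lambda>x. f x + g x)"
proof (induction k arbitrary: f g)
  case (Suc k)
  obtain df where df: "\<And>i x. i < n \<Longrightarrow> x \<in> U \<Longrightarrow> ((\<lambda>t. f (x(i := t))) has_real_derivative df i x) (at (x i))"
    "\<And>i. i < n \<Longrightarrow> C_diff k n U (df i)"
    using C_diff_SucE[OF Suc.prems(1)] by blast
  obtain dg where dg: "\<And>i x. i < n \<Longrightarrow> x \<in> U \<Longrightarrow> ((\<lambda>t. g (x(i := t))) has_real_derivative dg i x) (at (x i))"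
    "\<And>i. i < n \<Longrightarrow> C_diff k n U (dg i)"
    using C_diff_SucE[OF Suc.prems(2)] by blast
  show ?case
  proof (rule C_diff_SucI)
    show "continuous_on U (\<lambda>x. f x + g x)"
      using Suc.prems C_diff_imp_continuous_on by (blast intro: continuous_on_add)
    show "((\<lambda>t. f (x(i := t)) + g (x(i := t))) has_real_derivative df i x + dg i x) (at (x i))"
      if "i < n" "x \<in> U" for i x
      using DERIV_add[OF df(1)[OF that] dg(1)[OF that]] .
    show "C_diff k n U (\<lambda>x. df i x + dg i x)" if "i < n" for i
      using Suc.IH df(2) dg(2) that by blast
  qed
qed (auto intro: continuous_on_add)

lemma C_diff_mult:
  "C_diff k n U f \<Longrightarrow> C_diff k n U g \<Longrightarrow> C_diff k n U (\<lambda>x. f x * g x)"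
proof (induction k arbitrary: f g)
  case (Suc k)
  obtain df where df: "\<And>i x. i < n \<Longrightarrow> x \<in> U \<Longrightarrow> ((\<lambda>t. f (x(i := t))) has_real_derivative df i x) (at (x i))"
    "\<And>i. i < n \<Longrightarrow> C_diff k n U (df i)"
    using C_diff_SucE[OF Suc.prems(1)] by blast
  obtain dg where dg: "\<And>i x. i < n \<Longrightarrow> x \<in> U \<Longrightarrow> ((\<lambda>t. g (x(i := t))) has_real_derivative dg i x) (at (x i))"
    "\<And>i. i < n \<Longrightarrow> C_diff k n U (dg i)"
    using C_diff_SucE[OF Suc.prems(2)] by blast
  show ?case
  proof (rule C_diff_SucI)
    show "continuous_on U (\<lambda>x. f x * g x)"
      using Suc.prems C_diff_imp_continuous_on by (blast intro: continuous_on_mult)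
    show "((\<lambda>t. f (x(i := t)) * g (x(i := t))) has_real_derivative df i x * g x + dg i x * f x) (at (x i))"
      if "i < n" "x \<in> U" for i x
      using DERIV_mult[OF df(1)[OF that] dg(1)[OF that]] by simp
    \<comment> \<open>The product rule brings back \<open>f\<close> and \<open>g\<close>
      undifferentiated, so they are needed at order \<open>k\<close> too, whence
      \<open>C_diff_Suc_imp\<close>.\<close>
    show "C_diff k n U (\<lambda>x. df i x * g x + dg i x * f x)" if "i < n" for i
      using Suc df(2) dg(2) that C_diff_Suc_imp by (intro C_diff_add Suc.IH) blast+
  qed
qed (auto intro: continuous_on_mult)

lemma C_diff_sum:
  "(\<And>j. j < m \<Longrightarrow> C_diff k n U (f j)) \<Longrightarrow> C_diff k n U (\<lambda>x. \<Sum>j<m::nat. f j x)"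
proof (induction m)
  case 0
  show ?case using C_diff_const[of k n U 0] by simp
next
  case (Suc m)
  then have "C_diff k n U (\<lambda>x. \<Sum>j<m. f j x)" "C_diff k n U (f m)"
    by auto
  from C_diff_add[OF this] show ?case by simp
qed

text \<open>The coordinates of \<open>a\<close> are replaced by those of \<open>z\<close> one after the other, and the mean value
  theorem is applied to each step.\<close>

lemma mean_value_telescope:
  fixes g :: "(nat \<Rightarrow> real) \<Rightarrow> real"
  assumes z: "\<And>i. n \<le> i \<Longrightarrow> a i = 0" "\<And>i. n \<le> i \<Longrightarrow> z i = 0"
    and der: "\<And>j y. j < n \<Longrightarrow> (\<And>i. n \<le> i \<Longrightarrow> y i = 0) \<Longrightarrow> (\<And>i. \<bar>y i - a i\<bar> \<le> \<bar>z i - a i\<bar>) \<Longrightarrow>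
        ((\<lambda>s. g (y(j := s))) has_real_derivative G j y) (at (y j))"
  shows "\<exists>\<xi>. (\<forall>j i. n \<le> i \<longrightarrow> \<xi> j i = 0) \<and> (\<forall>j i. \<bar>\<xi> j i - a i\<bar> \<le> \<bar>z i - a i\<bar>) \<and>
    g z - g a = (\<Sum>j<n. G j (\<xi> j) * (z j - a j))"
proof -
  define w where "w j = (\<lambda>i. if i < j then z i else a i)" for j :: nat
  have "\<exists>\<xi>. (\<forall>i. n \<le> i \<longrightarrow> \<xi> i = 0) \<and> (\<forall>i. \<bar>\<xi> i - a i\<bar> \<le> \<bar>z i - a i\<bar>) \<and>
    (j < n \<longrightarrow> g (w (Suc j)) - g (w j) = G j \<xi> * (z j - a j))" for j
  proof (cases "j < n")
    case True
    define y where "y s = (w j)(j := s)" for s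
    have y0: "y (a j) = w j" "y (z j) = w (Suc j)"
      by (auto simp: y_def w_def fun_eq_iff less_Suc_eq)
    have bd: "\<bar>y s i - a i\<bar> \<le> \<bar>z i - a i\<bar>" if "s \<in> closed_segment (a j) (z j)" for s i
      using that by (auto simp: y_def w_def closed_segment_eq_real_ivl split: if_splits)
    have yz: "y s i = 0" if "n \<le> i" for s i
      using that True z by (auto simp: y_def w_def)
    have d: "((\<lambda>s. g (y s)) has_real_derivative G j (y s)) (at s)" if "s \<in> closed_segment (a j) (z j)" for s
      using der[OF True, of "y s"] bd[OF that] yz by (simp add: y_def)
    have "\<exists>s\<in>closed_segment (a j) (z j). g (y (z j)) - g (y (a j)) = G j (y s) * (z j - a j)"
    proof (cases "a j" "z j" rule: linorder_cases)
      case less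
      then obtain s where "a j < s" "s < z j" "g (y (z j)) - g (y (a j)) = (z j - a j) * G j (y s)"
        using MVT2[of "a j" "z j" "\<lambda>s. g (y s)" "\<lambda>s. G j (y s)"] d by (auto simp: closed_segment_eq_real_ivl)
      then show ?thesis using less by (intro bexI[of _ s]) (auto simp: closed_segment_eq_real_ivl)
    next
      case greater
      then obtain s where "z j < s" "s < a j" "g (y (a j)) - g (y (z j)) = (a j - z j) * G j (y s)"
        using MVT2[of "z j" "a j" "\<lambda>s. g (y s)" "\<lambda>s. G j (y s)"] d by (auto simp: closed_segment_eq_real_ivl)
      then show ?thesis using greater by (intro bexI[of _ s]) (auto simp: closed_segment_eq_real_ivl algebra_simps)
    qed auto
    then obtain s where s: "s \<in> closed_segment (a j) (z j)" "g (y (z j)) - g (y (a j)) = G j (y s) * (z j - a j)"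
      by blast
    then show ?thesis using bd[OF s(1)] yz y0 by (intro exI[of _ "y s"]) auto
  next
    case False
    \<comment> \<open>An index from \<open>n\<close> on asks for nothing but the bounds;
      \<open>a\<close> is a default value that meets them, so that a single family \<xi> over all
      indices can be chosen.\<close>
    then show ?thesis using z by (intro exI[of _ a]) auto
  qed
  then obtain \<xi> where \<xi>: "\<And>j i. n \<le> i \<Longrightarrow> \<xi> j i = 0" "\<And>j i. \<bar>\<xi> j i - a i\<bar> \<le> \<bar>z i - a i\<bar>"
    "\<And>j. j < n \<Longrightarrow> g (w (Suc j)) - g (w j) = G j (\<xi> j) * (z j - a j)"
    by metis
  have "w 0 = a" "w n = z"
    using z by (auto simp: w_def fun_eq_iff)
  then have "g z - g a = (\<Sum>j<n. g (w (Suc j)) - g (w j))"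
    using sum_lessThan_telescope[of "\<lambda>j. g (w j)" n] by simp
  then show ?thesis using \<xi> by (intro exI[of _ \<xi>]) auto
qed

text \<open>The difference quotient of \<open>g\<close> along \<gamma> is a sum of partial
  derivatives at intermediate points times difference quotients of the coordinates. The intermediate
  points are squeezed towards the base point, so continuity of the partial derivatives gives the
  limit.\<close>

lemma DERIV_compose_partials:
  fixes g :: "(nat \<Rightarrow> real) \<Rightarrow> real" and \<gamma> :: "real \<Rightarrow> nat \<Rightarrow> real"
  assumes V: "openin (Euclidean_space n) V"
    and der: "\<And>j y. j < n \<Longrightarrow> y \<in> V \<Longrightarrow> ((\<lambda>s. g (y(j := s))) has_real_derivative G j y) (at (y j))"
    and cont: "\<And>j. j < n \<Longrightarrow> continuous_on V (G j)"
    and \<gamma>V: "\<forall>\<^sub>F t in nhds t0. \<gamma> t \<in> V"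
    and \<gamma>: "\<And>j. j < n \<Longrightarrow> ((\<lambda>t. \<gamma> t j) has_real_derivative d j) (at t0)"
  shows "((\<lambda>t. g (\<gamma> t)) has_real_derivative (\<Sum>j<n. G j (\<gamma> t0) * d j)) (at t0)"
proof -
  let ?a = "\<gamma> t0"
  have a: "?a \<in> V" using \<gamma>V eventually_nhds_x_imp_x by blast
  obtain e where e: "e > 0" "\<And>y. (\<And>i. n \<le> i \<Longrightarrow> y i = 0) \<Longrightarrow> (\<And>i. i < n \<Longrightarrow> \<bar>y i - ?a i\<bar> < e) \<Longrightarrow> y \<in> V"
    using openin_Euclidean_space_box[OF V a] by metis
  have lim: "(\<lambda>t. \<gamma> t j) \<midarrow>t0\<rightarrow> ?a j" if "j < n" for j
    using \<gamma>[OF that] DERIV_isCont isCont_def by blast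
  define Q where "Q t \<xi> \<longleftrightarrow> (\<forall>j. \<xi> j \<in> V) \<and> (\<forall>j i. \<bar>\<xi> j i - ?a i\<bar> \<le> \<bar>\<gamma> t i - ?a i\<bar>) \<and>
      g (\<gamma> t) - g ?a = (\<Sum>j<n. G j (\<xi> j) * (\<gamma> t j - ?a j))" for t \<xi>
  have near: "\<forall>\<^sub>F t in at t0. \<gamma> t \<in> V \<and> (\<forall>j<n. \<bar>\<gamma> t j - ?a j\<bar> < e)"
  proof -
    have "\<forall>\<^sub>F t in at t0. \<forall>j\<in>{..<n}. \<bar>\<gamma> t j - ?a j\<bar> < e"
      using lim tendstoD[OF lim e(1)]
      by (intro eventually_ball_finite) (auto simp: dist_real_def)
    moreover have "\<forall>\<^sub>F t in at t0. \<gamma> t \<in> V"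
      using \<gamma>V by (simp add: eventually_at_filter eventually_mono)
    ultimately show ?thesis by eventually_elim auto
  qed
  have ex: "\<forall>\<^sub>F t in at t0. \<exists>\<xi>. Q t \<xi>"
    using near
  proof eventually_elim
    case (elim t)
    have inV: "y \<in> V" if "\<And>i. n \<le> i \<Longrightarrow> y i = 0" "\<And>i. \<bar>y i - ?a i\<bar> \<le> \<bar>\<gamma> t i - ?a i\<bar>" for y
      using that elim by (intro e(2)) (auto intro: le_less_trans)
    have "\<exists>\<xi>. (\<forall>j i. n \<le> i \<longrightarrow> \<xi> j i = 0) \<and> (\<forall>j i. \<bar>\<xi> j i - ?a i\<bar> \<le> \<bar>\<gamma> t i - ?a i\<bar>) \<and>
      g (\<gamma> t) - g ?a = (\<Sum>j<n. G j (\<xi> j) * (\<gamma> t j - ?a j))"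
    proof (rule mean_value_telescope)
      show "((\<lambda>s. g (y(j := s))) has_real_derivative G j y) (at (y j))"
        if "j < n" "\<And>i. n \<le> i \<Longrightarrow> y i = 0" "\<And>i. \<bar>y i - ?a i\<bar> \<le> \<bar>\<gamma> t i - ?a i\<bar>" for j y
        using der[OF that(1) inV] that by blast
    qed (use a elim openin_Euclidean_space_zero[OF V] in auto)
    then show ?case using inV unfolding Q_def by metis
  qed
  \<comment> \<open>Intermediate points exist only for \<open>t\<close> near \<open>t0\<close>; the
    choice operator makes them a function of \<open>t\<close>, whose limit can then be
    taken.\<close>
  define \<xi> where "\<xi> t = (SOME \<xi>. Q t \<xi>)" for t
  have \<xi>: "\<forall>\<^sub>F t in at t0. Q t (\<xi> t)"
    using ex unfolding \<xi>_def by (rule eventually_mono) (simp add: some_eq_ex)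
  note \<xi> = this[unfolded Q_def]
  have lim\<xi>: "((\<lambda>t. G j (\<xi> t j)) \<longlongrightarrow> G j ?a) (at t0)" if "j < n" for j
  proof (rule continuous_on_tendsto_compose[OF cont[OF that] _ a])
    have "((\<lambda>t. \<xi> t j i) \<longlongrightarrow> ?a i) (at t0)" for i
    proof -
      have "((\<lambda>t. \<gamma> t i - ?a i) \<longlongrightarrow> 0) (at t0)"
      proof (cases "i < n")
        case True
        then show ?thesis using lim LIM_zero by blast
      next
        \<comment> \<open>Convergence in the product topology concerns every coordinate. The
          hypothesis on derivatives covers those below \<open>n\<close>; the others vanish because
          \<gamma> stays in \<open>V\<close>.\<close>
        case False
        have "\<forall>\<^sub>F t in at t0. \<gamma> t i - ?a i = 0"
          using near
        proof eventually_elim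
          case (elim t)
          then show ?case
            using False openin_Euclidean_space_zero[OF V, of "\<gamma> t" i] openin_Euclidean_space_zero[OF V a, of i] by simp
        qed
        then show ?thesis by (simp add: tendsto_eventually)
      qed
      then have "((\<lambda>t. \<xi> t j i - ?a i) \<longlongrightarrow> 0) (at t0)"
        by (rule Lim_transform_bound[rotated]) (use \<xi> in eventually_elim, auto)
      then show ?thesis by (rule LIM_zero_cancel)
    qed
    then show "((\<lambda>t. \<xi> t j) \<longlongrightarrow> ?a) (at t0)"
      using limitin_componentwise[of "\<lambda>_. euclidean" UNIV "\<lambda>t. \<xi> t j" ?a "at t0"]
      by (simp add: euclidean_product_topology)
    show "\<forall>\<^sub>F t in at t0. \<xi> t j \<in> V"
      using \<xi> by eventually_elim auto
  qed
  have "((\<lambda>t. \<Sum>j<n. G j (\<xi> t j) * ((\<gamma> t j - ?a j) / (t - t0))) \<longlongrightarrow> (\<Sum>j<n. G j ?a * d j)) (at t0)"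
    using lim\<xi> \<gamma>[unfolded has_field_derivative_iff] by (intro tendsto_sum tendsto_mult) auto
  moreover have "\<forall>\<^sub>F t in at t0. (\<Sum>j<n. G j (\<xi> t j) * ((\<gamma> t j - ?a j) / (t - t0))) = (g (\<gamma> t) - g ?a) / (t - t0)"
    using \<xi> by eventually_elim (simp add: sum_divide_distrib)
  ultimately show ?thesis
    unfolding has_field_derivative_iff by (rule Lim_transform_eventually)
qed

text \<open>The chain rule writes a partial derivative of the composite as a sum of products of
  \<open>G j\<close> after \<open>f\<close> with partial derivatives of \<open>f\<close>. The
  induction varies \<open>g\<close> with \<open>f\<close> fixed, because its hypothesis is applied
  to the outer derivatives \<open>G j\<close>.\<close>

lemma C_diff_compose:
  assumes U: "openin (Euclidean_space m) U" and V: "openin (Euclidean_space n) V"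
    and fV: "\<And>x. x \<in> U \<Longrightarrow> f x \<in> V"
  shows "(\<And>j. j < n \<Longrightarrow> C_diff k m U (\<lambda>x. f x j)) \<Longrightarrow> C_diff k n V g \<Longrightarrow> C_diff k m U (\<lambda>x. g (f x))"
proof (induction k arbitrary: g)
  case 0
  have "continuous_on U f"
    using 0 C_diff_imp_continuous_on fV by (intro continuous_on_Euclidean_space[OF V]) blast+
  then show ?case
    using continuous_on_compose2[of V g U f] 0(2) fV by auto
next
  case (Suc k)
  have cont: "continuous_on U f"
    using Suc.prems(1) C_diff_imp_continuous_on fV by (intro continuous_on_Euclidean_space[OF V]) blast+
  obtain G where G: "\<And>j y. j < n \<Longrightarrow> y \<in> V \<Longrightarrow> ((\<lambda>s. g (y(j := s))) has_real_derivative G j y) (at (y j))"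
    "\<And>j. j < n \<Longrightarrow> C_diff k n V (G j)"
    using C_diff_SucE[OF Suc.prems(2)] by blast
  have "\<exists>d. \<forall>j. j < n \<longrightarrow> (\<forall>i x. i < m \<longrightarrow> x \<in> U \<longrightarrow>
      ((\<lambda>t. f (x(i := t)) j) has_real_derivative d j i x) (at (x i))) \<and> (\<forall>i<m. C_diff k m U (d j i))"
  proof (rule choice, rule allI)
    fix j show "\<exists>d. j < n \<longrightarrow> (\<forall>i x. i < m \<longrightarrow> x \<in> U \<longrightarrow>
      ((\<lambda>t. f (x(i := t)) j) has_real_derivative d i x) (at (x i))) \<and> (\<forall>i<m. C_diff k m U (d i))"
    proof (cases "j < n")
      case True
      obtain d where "\<And>i x. i < m \<Longrightarrow> x \<in> U \<Longrightarrow> ((\<lambda>t. f (x(i := t)) j) has_real_derivative d i x) (at (x i))"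
        "\<And>i. i < m \<Longrightarrow> C_diff k m U (d i)"
        using C_diff_SucE[OF Suc.prems(1)[OF True]] by blast
      then show ?thesis by (intro exI[of _ d]) simp
    qed auto
  qed
  then obtain d where d: "\<And>j i x. j < n \<Longrightarrow> i < m \<Longrightarrow> x \<in> U \<Longrightarrow>
      ((\<lambda>t. f (x(i := t)) j) has_real_derivative d j i x) (at (x i))"
    "\<And>j i. j < n \<Longrightarrow> i < m \<Longrightarrow> C_diff k m U (d j i)"
    by blast
  show ?case
  proof (rule C_diff_SucI)
    show "continuous_on U (\<lambda>x. g (f x))"
      using continuous_on_compose2[OF C_diff_imp_continuous_on[OF Suc.prems(2)] cont] fV by blast
    show "((\<lambda>t. g (f (x(i := t)))) has_real_derivative (\<Sum>j<n. G j (f x) * d j i x)) (at (x i))"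
      if "i < m" "x \<in> U" for i x
    proof -
      \<comment> \<open>The curve is \<open>f (x(i := t))\<close> at time \<open>x i\<close>; its
        base point first appears as \<open>f (x(i := x i))\<close>, which is
        \<open>f x\<close>.\<close>
      have "((\<lambda>t. g (f (x(i := t)))) has_real_derivative (\<Sum>j<n. G j (f (x(i := x i))) * d j i x)) (at (x i))"
      proof (rule DERIV_compose_partials[OF V G(1) C_diff_imp_continuous_on[OF G(2)]])
        show "\<forall>\<^sub>F t in nhds (x i). f (x(i := t)) \<in> V"
          using openin_Euclidean_space_update[OF U that(2,1)] by eventually_elim (rule fV)
      qed (use d that in auto)
      then show ?thesis by simp
    qed
    show "C_diff k m U (\<lambda>x. \<Sum>j<n. G j (f x) * d j i x)" if "i < m" for i
    proof (rule C_diff_sum, rule C_diff_mult)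
      fix j assume j: "j < n"
      have "C_diff k m U (\<lambda>x. f x j)" if "j < n" for j
        using C_diff_Suc_imp[OF Suc.prems(1)[OF that]] .
      from this G(2)[OF j] show "C_diff k m U (\<lambda>x. G j (f x))"
        by (rule Suc.IH)
      show "C_diff k m U (d j i)"
        using d(2)[OF j that] .
    qed
  qed
qed

section \<open>Smooth maps between manifolds\<close>

lemma smooth_on_subset: "smooth_on n U f \<Longrightarrow> V \<subseteq> U \<Longrightarrow> smooth_on n V f"
  unfolding smooth_on_def using C_diff_subset by blast

lemma smooth_on_const: "smooth_on n U (\<lambda>x. c)"
  unfolding smooth_on_def using C_diff_const by blast

lemma smooth_on_cong:
  assumes "openin (Euclidean_space n) U" "\<And>x. x \<in> U \<Longrightarrow> f x = g x" "smooth_on n U f"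
  shows "smooth_on n U g"
  unfolding smooth_on_def
proof
  fix k from assms(3) have f: "C_diff k n U f" unfolding smooth_on_def ..
  show "C_diff k n U g" by (rule C_diff_cong[OF assms(1) _ f]) (rule assms(2))
qed

lemma smooth_on_local:
  assumes "openin (Euclidean_space n) U"
    and "\<And>x. x \<in> U \<Longrightarrow> \<exists>V. openin (Euclidean_space n) V \<and> x \<in> V \<and> V \<subseteq> U \<and> smooth_on n V f"
  shows "smooth_on n U f"
  unfolding smooth_on_def
proof
  fix k show "C_diff k n U f"
  proof (rule C_diff_local[OF assms(1)])
    fix x assume "x \<in> U"
    from assms(2)[OF this] obtain V
      where "openin (Euclidean_space n) V" "x \<in> V" "V \<subseteq> U" "\<forall>k. C_diff k n V f"
      unfolding smooth_on_def by blast
    then show "\<exists>V. openin (Euclidean_space n) V \<and> x \<in> V \<and> V \<subseteq> U \<and> C_diff k n V f"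
      by (intro exI[of _ V]) simp
  qed
qed

lemma smooth_on_compose:
  assumes "openin (Euclidean_space m) U" "openin (Euclidean_space n) V"
    and "\<And>x. x \<in> U \<Longrightarrow> f x \<in> V" "\<And>j. j < n \<Longrightarrow> smooth_on m U (\<lambda>x. f x j)" "smooth_on n V g"
  shows "smooth_on m U (\<lambda>x. g (f x))"
  unfolding smooth_on_def
proof
  fix k show "C_diff k m U (\<lambda>x. g (f x))"
    by (rule C_diff_compose[OF assms(1-3)]) (use assms(4,5) in \<open>simp_all add: smooth_on_def\<close>)
qed

lemma openin_Euclidean_space_preimage:
  assumes "openin (Euclidean_space n) U" "continuous_on U c" "open W"
  shows "openin (Euclidean_space n) (U \<inter> c -` W)"
  using openin_trans[OF continuous_openin_preimage_gen[OF assms(2,3)]] assms(1)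
  unfolding openin_Euclidean_space_iff by simp

text \<open>Compatibility of the charts is left out of this notion: it is not needed for the composition of
  smooth maps, and so need not be verified for products.\<close>

definition charted :: "'m::topological_space smooth_structure \<Rightarrow> bool" where
  "charted M \<longleftrightarrow> (\<forall>x. \<exists>(U, \<phi>)\<in>atlas M. x \<in> U) \<and>
     (\<forall>(U, \<phi>)\<in>atlas M. open U \<and> openin (Euclidean_space (mdim M)) (\<phi> ` U) \<and> inj_on \<phi> U \<and>
        continuous_on U \<phi> \<and> continuous_on (\<phi> ` U) (inv_into U \<phi>))"

lemma chartedE:
  assumes "charted M"
  obtains U \<phi> where "(U, \<phi>) \<in> atlas M" "x \<in> U"
  using assms unfolding charted_def by blast

lemma chartedD:
  assumes "charted M" "(U, \<phi>) \<in> atlas M"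
  shows "open U" "openin (Euclidean_space (mdim M)) (\<phi> ` U)" "inj_on \<phi> U"
    "continuous_on U \<phi>" "continuous_on (\<phi> ` U) (inv_into U \<phi>)"
  using assms unfolding charted_def by auto

lemma smooth_manifold_imp_charted: 
  assumes "smooth_manifold M" shows "charted M"
proof -
  have "\<exists>(U, \<phi>)\<in>atlas M. x \<in> U" for x
    using assms UNIV_I[of x] unfolding smooth_manifold_def by blast
  moreover have "inj_on \<phi> U \<and> continuous_on U \<phi> \<and> continuous_on (\<phi> ` U) (inv_into U \<phi>)"
    if "homeomorphism U (\<phi> ` U) \<phi> (inv_into U \<phi>)" for U and \<phi> :: "'a \<Rightarrow> nat \<Rightarrow> real"
    using that unfolding homeomorphism_def by (metis inj_on_inverseI)
  ultimately show ?thesis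
    using assms unfolding charted_def smooth_manifold_def by fast
qed

lemma openin_chart_image:
  assumes "charted M" "(U, \<phi>) \<in> atlas M" "open W"
  shows "openin (Euclidean_space (mdim M)) (\<phi> ` (U \<inter> W))"
proof -
  note ch = chartedD[OF assms(1,2)]
  have "\<phi> ` (U \<inter> W) = \<phi> ` U \<inter> inv_into U \<phi> -` W"
    using ch(3) by (auto simp: inv_into_f_f)
  then show ?thesis
    using openin_Euclidean_space_preimage[OF ch(2,5) assms(3)] by simp
qed

section \<open>Smooth parametrisations of manifolds and their composition\<close>

lemma smooth_intoI:
  assumes "openin (Euclidean_space n) U" "continuous_on U c"
    and "\<And>V \<psi> j. (V, \<psi>) \<in> atlas M \<Longrightarrow> j < mdim M \<Longrightarrow> smooth_on n (U \<inter> c -` V) (\<lambda>x. \<psi> (c x) j)"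
  shows "smooth_into M n U c"
  using assms unfolding smooth_into_def by auto

lemma smooth_intoD:
  assumes "smooth_into M n U c"
  shows "openin (Euclidean_space n) U" "continuous_on U c"
    "(V, \<psi>) \<in> atlas M \<Longrightarrow> j < mdim M \<Longrightarrow> smooth_on n (U \<inter> c -` V) (\<lambda>x. \<psi> (c x) j)"
  using assms unfolding smooth_into_def by auto

lemma smooth_into_subset:
  assumes "smooth_into M n U c" "openin (Euclidean_space n) V" "V \<subseteq> U"
  shows "smooth_into M n V c"
proof (rule smooth_intoI)
  show "continuous_on V c"
    using smooth_intoD(2)[OF assms(1)] assms(3) continuous_on_subset by blast
  show "smooth_on n (V \<inter> c -` A) (\<lambda>x. \<psi> (c x) j)" if "(A, \<psi>) \<in> atlas M" "j < mdim M" for A \<psi> j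
    using assms(3) by (intro smooth_on_subset[OF smooth_intoD(3)[OF assms(1) that]]) auto
qed (rule assms(2))

lemma smooth_into_cong:
  assumes "charted M" "smooth_into M n U c" "\<And>x. x \<in> U \<Longrightarrow> c x = d x"
  shows "smooth_into M n U d"
proof (rule smooth_intoI)
  note c = smooth_intoD[OF assms(2)]
  show "openin (Euclidean_space n) U" by (rule c)
  show "continuous_on U d" using c(2) assms(3) by (rule continuous_on_eq)
  fix V \<psi> j assume V: "(V, \<psi>) \<in> atlas M" and j: "j < mdim M"
  have eq: "U \<inter> d -` V = U \<inter> c -` V" using assms(3) by auto
  have op: "openin (Euclidean_space n) (U \<inter> c -` V)"
    using openin_Euclidean_space_preimage[OF c(1,2) chartedD(1)[OF assms(1) V]] .
  show "smooth_on n (U \<inter> d -` V) (\<lambda>y. \<psi> (d y) j)"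
    unfolding eq by (rule smooth_on_cong[OF op _ c(3)[OF V j]]) (simp add: assms(3))
qed

lemma smooth_into_local:
  assumes M: "charted M" and U: "openin (Euclidean_space n) U"
    and loc: "\<And>x. x \<in> U \<Longrightarrow> \<exists>V. x \<in> V \<and> V \<subseteq> U \<and> smooth_into M n V c"
  shows "smooth_into M n U c"
proof (rule smooth_intoI)
  show cont: "continuous_on U c"
  proof (rule continuous_on_local)
    fix x assume "x \<in> U"
    from loc[OF this] obtain V where V: "x \<in> V" "V \<subseteq> U" "smooth_into M n V c" by blast
    show "\<exists>V. openin (top_of_set U) V \<and> x \<in> V \<and> continuous_on V c"
      using V(1) smooth_intoD(2)[OF V(3)]
        openin_Euclidean_space_imp_subset[OF smooth_intoD(1)[OF V(3)] V(2) U] by auto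
  qed
  show "smooth_on n (U \<inter> c -` A) (\<lambda>x. \<psi> (c x) j)" if A: "(A, \<psi>) \<in> atlas M" and j: "j < mdim M" for A \<psi> j
  proof (rule smooth_on_local)
    show "openin (Euclidean_space n) (U \<inter> c -` A)"
      using openin_Euclidean_space_preimage[OF U cont chartedD(1)[OF M A]] .
    fix x assume x: "x \<in> U \<inter> c -` A"
    with loc[of x] obtain V where V: "x \<in> V" "V \<subseteq> U" "smooth_into M n V c" by blast
    note v = smooth_intoD[OF V(3)]
    show "\<exists>V. openin (Euclidean_space n) V \<and> x \<in> V \<and> V \<subseteq> U \<inter> c -` A \<and> smooth_on n V (\<lambda>x. \<psi> (c x) j)"
      using openin_Euclidean_space_preimage[OF v(1,2) chartedD(1)[OF M A]] v(3)[OF A j] x V(1,2)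
      by (intro exI[of _ "V \<inter> c -` A"]) auto
  qed
qed (rule U)

text \<open>The composite is the coordinate expression of \<open>g\<close> after \<phi> \<circ>
  \<open>c\<close>, so the Euclidean chain rule applies. The set \<open>W\<close> cuts the chart
  down to the part where that expression is known to be smooth.\<close>

lemma smooth_into_compose_chart:
  assumes M: "charted M" and c: "smooth_into M n U c" and A: "(A, \<phi>) \<in> atlas M"
    and W: "open W" and g: "smooth_on (mdim M) (\<phi> ` (A \<inter> W)) (\<lambda>y. g (inv_into A \<phi> y))"
  shows "openin (Euclidean_space n) (U \<inter> c -` (A \<inter> W))"
    and "smooth_on n (U \<inter> c -` (A \<inter> W)) (\<lambda>x. g (c x))"
proof -
  note ch = chartedD[OF M A]
  show op: "openin (Euclidean_space n) (U \<inter> c -` (A \<inter> W))"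
    using openin_Euclidean_space_preimage[OF smooth_intoD(1,2)[OF c] open_Int[OF ch(1) W]] .
  have "smooth_on n (U \<inter> c -` (A \<inter> W)) (\<lambda>x. (\<lambda>y. g (inv_into A \<phi> y)) (\<phi> (c x)))"
  proof (rule smooth_on_compose[OF op openin_chart_image[OF M A W] _ _ g])
    show "smooth_on n (U \<inter> c -` (A \<inter> W)) (\<lambda>x. \<phi> (c x) j)" if "j < mdim M" for j
      by (rule smooth_on_subset[OF smooth_intoD(3)[OF c A that]]) auto
  qed auto
  then show "smooth_on n (U \<inter> c -` (A \<inter> W)) (\<lambda>x. g (c x))"
    by (rule smooth_on_cong[OF op, rotated]) (use ch(3) in auto)
qed

text \<open>Smoothness is local on the domain, so one chart of \<open>M\<close> around
  \<open>c x\<close> suffices; continuity of \<open>f\<close> makes the part of \<open>W\<close>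
  sent into a chart of \<open>N\<close> open.\<close>

lemma smooth_into_compose:
  assumes M: "charted M" and N: "charted N" and c: "smooth_into M n U c"
    and f: "smooth_map_on W M N f" and W: "open W" and cW: "\<And>x. x \<in> U \<Longrightarrow> c x \<in> W"
  shows "smooth_into N n U (\<lambda>x. f (c x))"
proof (rule smooth_intoI)
  note c' = smooth_intoD[OF c]
  show U: "openin (Euclidean_space n) U" by (rule c')
  have fc: "continuous_on W f"
    using f unfolding smooth_map_on_def by blast
  show cont: "continuous_on U (\<lambda>x. f (c x))"
    using continuous_on_compose2[OF fc c'(2)] cW by blast
  fix B \<psi> j assume B: "(B, \<psi>) \<in> atlas N" and j: "j < mdim N"
  note oB = chartedD(1)[OF N B]
  show "smooth_on n (U \<inter> (\<lambda>x. f (c x)) -` B) (\<lambda>x. \<psi> (f (c x)) j)"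
  proof (rule smooth_on_local)
    show "openin (Euclidean_space n) (U \<inter> (\<lambda>x. f (c x)) -` B)"
      using openin_Euclidean_space_preimage[OF U cont oB] .
    fix x assume x: "x \<in> U \<inter> (\<lambda>x. f (c x)) -` B"
    obtain A \<phi> where A: "(A, \<phi>) \<in> atlas M" "c x \<in> A" using chartedE[OF M] .
    let ?W = "W \<inter> f -` B"
    have W': "open ?W" using continuous_open_preimage[OF fc W oB] .
    have eq: "W \<inter> A \<inter> f -` B = A \<inter> ?W" by auto
    have "smooth_on (mdim M) (\<phi> ` (W \<inter> A \<inter> f -` B)) (\<lambda>y. \<psi> (f (inv_into A \<phi> y)) j)"
      using f A(1) B j unfolding smooth_map_on_def by blast
    note smooth_into_compose_chart[OF M c A(1) W' this[unfolded eq]]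
    then show "\<exists>V. openin (Euclidean_space n) V \<and> x \<in> V \<and> V \<subseteq> U \<inter> (\<lambda>x. f (c x)) -` B \<and>
        smooth_on n V (\<lambda>x. \<psi> (f (c x)) j)"
      using x A(2) cW by (intro exI[of _ "U \<inter> c -` (A \<inter> ?W)"]) auto
  qed
qed

lemma smooth_functions_compose:
  assumes M: "charted M" and c: "smooth_into M n U c" and f: "f \<in> smooth_functions M"
  shows "smooth_on n U (\<lambda>x. f (c x))"
proof (rule smooth_on_local)
  show "openin (Euclidean_space n) U" using smooth_intoD(1)[OF c] .
  fix x assume x: "x \<in> U"
  obtain A \<phi> where A: "(A, \<phi>) \<in> atlas M" "c x \<in> A" using chartedE[OF M] .
  have "smooth_on (mdim M) (\<phi> ` (A \<inter> UNIV)) (\<lambda>y. f (inv_into A \<phi> y))"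
    using f A(1) unfolding smooth_functions_def by (auto simp: o_def)
  note smooth_into_compose_chart[OF M c A(1) open_UNIV this]
  then show "\<exists>V. openin (Euclidean_space n) V \<and> x \<in> V \<and> V \<subseteq> U \<and> smooth_on n V (\<lambda>x. f (c x))"
    using x A(2) by (intro exI[of _ "U \<inter> c -` A"]) auto
qed

text \<open>Here the compatibility of charts enters: in the coordinates of another chart, the
  inverse of a chart is a transition map.\<close>

lemma smooth_into_chart_inverse:
  assumes M: "smooth_manifold M" and U: "(U, \<phi>) \<in> atlas M"
  shows "smooth_into M (mdim M) (\<phi> ` U) (inv_into U \<phi>)"
proof (rule smooth_intoI)
  note ch = chartedD[OF smooth_manifold_imp_charted[OF M] U]
  show "openin (Euclidean_space (mdim M)) (\<phi> ` U)" "continuous_on (\<phi> ` U) (inv_into U \<phi>)"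
    by (fact ch)+
  fix V \<psi> j assume V: "(V, \<psi>) \<in> atlas M" "j < mdim M"
  have eq: "\<phi> ` U \<inter> inv_into U \<phi> -` V = \<phi> ` (U \<inter> V)"
    using ch(3) by (auto simp: inv_into_f_f)
  have "\<forall>(U, \<phi>)\<in>atlas M. \<forall>(V, \<psi>)\<in>atlas M. \<forall>j<mdim M.
        smooth_on (mdim M) (\<phi> ` (U \<inter> V)) (\<lambda>x. \<psi> (inv_into U \<phi> x) j)"
    using M unfolding smooth_manifold_def by blast
  then show "smooth_on (mdim M) (\<phi> ` U \<inter> inv_into U \<phi> -` V) (\<lambda>x. \<psi> (inv_into U \<phi> x) j)"
    unfolding eq using U V by blast
qed

lemma smooth_functions_pullback:
  assumes M: "smooth_manifold M" and N: "charted N" and p: "smooth_map M N p"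
    and f: "f \<in> smooth_functions N"
  shows "f \<circ> p \<in> smooth_functions M"
proof -
  have "smooth_on (mdim M) (\<phi> ` U) (\<lambda>x. f (p (inv_into U \<phi> x)))" if U: "(U, \<phi>) \<in> atlas M" for U \<phi>
    using smooth_functions_compose[OF N _ f] p
      smooth_into_compose[OF smooth_manifold_imp_charted[OF M] N smooth_into_chart_inverse[OF M U] p]
    by simp
  then show ?thesis
    unfolding smooth_functions_def by (auto simp: o_def)
qed

lemma smooth_map_local:
  assumes M: "charted M" and N: "charted N"
    and loc: "\<And>x. \<exists>W. x \<in> W \<and> open W \<and> smooth_map_on W M N f"
  shows "smooth_map M N f"
proof -
  have cont: "continuous_on UNIV f"
  proof (rule continuous_on_local)
    fix x
    obtain W where "x \<in> W" "open W" "smooth_map_on W M N f" using loc by blast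
    then show "\<exists>V. openin (top_of_set UNIV) V \<and> x \<in> V \<and> continuous_on V f"
      unfolding smooth_map_on_def by (intro exI[of _ W]) auto
  qed
  have "smooth_on (mdim M) (\<phi> ` (UNIV \<inter> U \<inter> f -` V)) (\<lambda>x. \<psi> (f (inv_into U \<phi> x)) j)"
    if U: "(U, \<phi>) \<in> atlas M" and V: "(V, \<psi>) \<in> atlas N" and j: "j < mdim N" for U \<phi> V \<psi> j
  proof (rule smooth_on_local)
    have oV: "open (f -` V)"
      using cont chartedD(1)[OF N V] by (simp add: continuous_on_open_vimage)
    show "openin (Euclidean_space (mdim M)) (\<phi> ` (UNIV \<inter> U \<inter> f -` V))"
      using openin_chart_image[OF M U oV] by simp
    fix x assume "x \<in> \<phi> ` (UNIV \<inter> U \<inter> f -` V)"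
    then obtain u where u: "x = \<phi> u" "u \<in> U" "f u \<in> V" by auto
    obtain W where W: "u \<in> W" "open W" "smooth_map_on W M N f" using loc by blast
    have "smooth_on (mdim M) (\<phi> ` (W \<inter> U \<inter> f -` V)) (\<lambda>x. \<psi> (f (inv_into U \<phi> x)) j)"
      using W(3) U V j unfolding smooth_map_on_def by blast
    moreover have "openin (Euclidean_space (mdim M)) (\<phi> ` (W \<inter> U \<inter> f -` V))"
      using openin_chart_image[OF M U open_Int[OF W(2) oV]] by (simp add: Int_ac)
    ultimately show "\<exists>A. openin (Euclidean_space (mdim M)) A \<and> x \<in> A \<and> A \<subseteq> \<phi> ` (UNIV \<inter> U \<inter> f -` V) \<and>
        smooth_on (mdim M) A (\<lambda>x. \<psi> (f (inv_into U \<phi> x)) j)"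
      using u W(1) by (intro exI[of _ "\<phi> ` (W \<inter> U \<inter> f -` V)"]) auto
  qed
  then show ?thesis
    using cont unfolding smooth_map_on_def by auto
qed

section \<open>Products of manifolds\<close>

text \<open>Local trivialisations of \<open>D\<close> take values in such a product, so composing
  with their inverses requires its charts to be legitimate.\<close>

lemma charted_prod_structure:
  assumes M: "charted M" and N: "charted N"
  shows "charted (prod_structure M N)"
  unfolding charted_def
proof (intro conjI allI ballI, goal_cases)
  case (1 z)
  obtain U \<phi> where U: "(U, \<phi>) \<in> atlas M" "fst z \<in> U" using chartedE[OF M] .
  obtain V \<psi> where V: "(V, \<psi>) \<in> atlas N" "snd z \<in> V" using chartedE[OF N] .
  have "(U \<times> V, \<lambda>(x, y) i. if i < mdim M then \<phi> x i else \<psi> y (i - mdim M)) \<in> atlas (prod_structure M N)"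
    unfolding prod_structure_def using U V by auto
  then show ?case
    by (rule bexI[rotated]) (use U V in \<open>auto simp: mem_Times_iff\<close>)
next
  case (2 C)
  let ?m = "mdim M" and ?n = "mdim N"
  obtain U \<phi> V \<psi> where C: "C = (U \<times> V, \<lambda>(x, y) i. if i < ?m then \<phi> x i else \<psi> y (i - ?m))"
    and U: "(U, \<phi>) \<in> atlas M" and V: "(V, \<psi>) \<in> atlas N"
    using 2 unfolding prod_structure_def by auto
  note u = chartedD[OF M U] and v = chartedD[OF N V]
  define \<theta> where "\<theta> = (\<lambda>(x, y) i. if i < ?m then \<phi> x i else \<psi> y (i - ?m))"
  \<comment> \<open>The maps \<open>a\<close> and \<open>b\<close> undo the concatenation of
    coordinates: the first \<open>?m\<close> padded by zeros, and the remaining ones shifted down.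
    Both are continuous on the whole sequence space.\<close>
  define a :: "(nat \<Rightarrow> real) \<Rightarrow> nat \<Rightarrow> real" where "a z = (\<lambda>i. if i < ?m then z i else 0)" for z
  define b :: "(nat \<Rightarrow> real) \<Rightarrow> nat \<Rightarrow> real" where "b z = (\<lambda>i. z (i + ?m))" for z
  have a\<theta>: "a (\<theta> (x, y)) = \<phi> x" if "x \<in> U" for x y
    using openin_Euclidean_space_zero[OF u(2) imageI[OF that]] by (auto simp: a_def \<theta>_def fun_eq_iff)
  have b\<theta>: "b (\<theta> (x, y)) = \<psi> y" for x y
    by (auto simp: b_def \<theta>_def fun_eq_iff)
  have ca: "continuous_on S a" for S
    unfolding a_def
  proof (rule continuous_on_coordinatewise_then_product)
    fix i show "continuous_on S (\<lambda>z. if i < ?m then z i else 0)"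
      by (cases "i < ?m") (auto intro: continuous_on_subset[OF continuous_on_product_coordinates])
  qed
  have cb: "continuous_on S b" for S
    unfolding b_def
    by (intro continuous_on_coordinatewise_then_product continuous_on_subset[OF continuous_on_product_coordinates]) auto
  obtain S where S: "open S" "\<phi> ` U = {x. \<forall>i\<ge>?m. x i = 0} \<inter> S"
    using u(2) unfolding openin_Euclidean_space_iff openin_open by auto
  obtain T where T: "open T" "\<psi> ` V = {x. \<forall>i\<ge>?n. x i = 0} \<inter> T"
    using v(2) unfolding openin_Euclidean_space_iff openin_open by auto
  have im: "\<theta> ` (U \<times> V) = {x. \<forall>i\<ge>?m + ?n. x i = 0} \<inter> (a -` S \<inter> b -` T)" (is "?L = ?R")
  proof (intro equalityI subsetI)
    fix z assume "z \<in> ?L"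
    then obtain x y where z: "z = \<theta> (x, y)" "x \<in> U" "y \<in> V" by auto
    have "\<psi> y (i - ?m) = 0" if "i \<ge> ?m + ?n" for i
      using openin_Euclidean_space_zero[OF v(2) imageI[OF z(3)]] that by auto
    then have "\<forall>i\<ge>?m + ?n. z i = 0" using z(1) by (auto simp: \<theta>_def)
    then show "z \<in> ?R"
      using z(2,3) S(2) T(2) a\<theta>[OF z(2)] b\<theta> unfolding z(1) by auto
  next
    fix z assume z: "z \<in> ?R"
    then have "a z \<in> \<phi> ` U" unfolding S(2) by (auto simp: a_def)
    moreover have "b z \<in> \<psi> ` V" using z unfolding T(2) by (auto simp: b_def)
    ultimately obtain x y where xy: "a z = \<phi> x" "b z = \<psi> y" "x \<in> U" "y \<in> V" by auto
    have "z i = (if i < ?m then a z i else b z (i - ?m))" for i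
      by (auto simp: a_def b_def)
    then have "z = \<theta> (x, y)" unfolding \<theta>_def xy by auto
    then show "z \<in> ?L" using xy by auto
  qed
  have inj: "inj_on \<theta> (U \<times> V)"
  proof (rule inj_onI, clarify)
    fix x y x' y' assume xy: "x \<in> U" "y \<in> V" "x' \<in> U" "y' \<in> V" "\<theta> (x, y) = \<theta> (x', y')"
    then have "\<phi> x = \<phi> x'" "\<psi> y = \<psi> y'"
      using a\<theta>[OF xy(1)] a\<theta>[OF xy(3)] b\<theta> by metis+
    then show "x = x' \<and> y = y'" using u(3) v(3) xy by (auto dest: inj_onD)
  qed
  have inv: "inv_into (U \<times> V) \<theta> z = (inv_into U \<phi> (a z), inv_into V \<psi> (b z))" if z: "z \<in> \<theta> ` (U \<times> V)" for z
  proof -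
    obtain x y where xy: "z = \<theta> (x, y)" "x \<in> U" "y \<in> V" using z by auto
    then show ?thesis
      using inv_into_f_f[OF inj, of "(x, y)"] a\<theta>[OF xy(2)] b\<theta> inv_into_f_f[OF u(3) xy(2)] inv_into_f_f[OF v(3) xy(3)]
      by simp
  qed
  have "open (U \<times> V)" using u(1) v(1) by (rule open_Times)
  moreover have "openin (Euclidean_space (mdim (prod_structure M N))) (\<theta> ` (U \<times> V))"
    unfolding openin_Euclidean_space_iff im
    using open_Int[OF open_vimage[OF S(1) ca] open_vimage[OF T(1) cb]]
    by (auto simp: prod_structure_def openin_open)
  moreover have "continuous_on (U \<times> V) \<theta>"
  proof (rule continuous_on_coordinatewise_then_product)
    fix i
    have "continuous_on (U \<times> V) (\<lambda>z. \<phi> (fst z) i)" "continuous_on (U \<times> V) (\<lambda>z. \<psi> (snd z) (i - ?m))"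
      using continuous_on_product_then_coordinatewise[OF u(4)] continuous_on_product_then_coordinatewise[OF v(4)]
      by (auto intro!: continuous_on_compose2[OF _ continuous_on_fst[OF continuous_on_id]]
          continuous_on_compose2[OF _ continuous_on_snd[OF continuous_on_id]])
    then show "continuous_on (U \<times> V) (\<lambda>z. \<theta> z i)"
      by (cases "i < ?m") (simp_all add: \<theta>_def case_prod_unfold)
  qed
  moreover have "continuous_on (\<theta> ` (U \<times> V)) (inv_into (U \<times> V) \<theta>)"
  proof (rule continuous_on_eq)
    have "a ` \<theta> ` (U \<times> V) \<subseteq> \<phi> ` U" "b ` \<theta> ` (U \<times> V) \<subseteq> \<psi> ` V"
      using a\<theta> b\<theta> by auto
    then show "continuous_on (\<theta> ` (U \<times> V)) (\<lambda>z. (inv_into U \<phi> (a z), inv_into V \<psi> (b z)))"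
      using continuous_on_compose2[OF u(5) ca] continuous_on_compose2[OF v(5) cb]
      by (intro continuous_on_Pair) auto
  qed (simp add: inv)
  ultimately show ?case
    using inj unfolding C \<theta>_def by simp
qed

text \<open>This supplies local sections of a bundle: in a trivialisation, a plot of the base is
  followed with the fibre coordinate frozen at \<open>y\<close>.\<close>

lemma smooth_into_Pair_const:
  assumes c: "smooth_into M n U c"
  shows "smooth_into (prod_structure M N) n U (\<lambda>x. (c x, y))"
proof (rule smooth_intoI)
  note c' = smooth_intoD[OF c]
  show "openin (Euclidean_space n) U" by (rule c')
  show "continuous_on U (\<lambda>x. (c x, y))"
    using c'(2) by (intro continuous_on_Pair continuous_on_const)
  fix C \<theta> j assume C: "(C, \<theta>) \<in> atlas (prod_structure M N)"
  let ?m = "mdim M"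
  obtain A \<phi> B \<psi> where C: "C = A \<times> B" "\<theta> = (\<lambda>(x, y) i. if i < ?m then \<phi> x i else \<psi> y (i - ?m))"
    and A: "(A, \<phi>) \<in> atlas M"
    using C unfolding prod_structure_def by auto
  have "smooth_on n (U \<inter> (\<lambda>x. (c x, y)) -` (A \<times> B)) (\<lambda>x. if j < ?m then \<phi> (c x) j else \<psi> y (j - ?m))"
  proof (cases "j < ?m")
    case True
    have "smooth_on n (U \<inter> (\<lambda>x. (c x, y)) -` (A \<times> B)) (\<lambda>x. \<phi> (c x) j)"
      by (rule smooth_on_subset[OF c'(3)[OF A True]]) auto
    then show ?thesis using True by simp
  qed (simp add: smooth_on_const)
  then show "smooth_on n (U \<inter> (\<lambda>x. (c x, y)) -` C) (\<lambda>x. \<theta> (c x, y) j)"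
    unfolding C by simp
qed

section \<open>Lifting curves and leaves to coverings\<close>

text \<open>Being joined by a path is an equivalence relation, so on a connected space it is enough
  that it holds near each point. There a coordinate box about \<phi> \<open>a\<close> contains the
  segments to its points, and the inverse chart carries them back.\<close>

lemma path_component_charted:
  fixes M :: "'m::topological_space smooth_structure"
  assumes M: "charted M" and "connected (UNIV :: 'm set)"
  shows "path_component UNIV (a::'m) b"
proof (rule connected_equivalence_relation[OF assms(2)])
  fix a :: 'm
  obtain U \<phi> where U: "(U, \<phi>) \<in> atlas M" "a \<in> U" using chartedE[OF M] .
  note ch = chartedD[OF M U(1)]
  obtain e where e: "e > 0" "\<And>y. (\<And>i. mdim M \<le> i \<Longrightarrow> y i = 0) \<Longrightarrow>
      (\<And>i. i < mdim M \<Longrightarrow> \<bar>y i - \<phi> a i\<bar> < e) \<Longrightarrow> y \<in> \<phi> ` U"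
    using openin_Euclidean_space_box[OF ch(2) imageI[OF U(2)]] by metis
  define B where "B = (\<Inter>i<mdim M. (\<lambda>y::nat \<Rightarrow> real. y i) -` ball (\<phi> a i) e)"
  have "open B"
    unfolding B_def by (intro open_INT ballI open_vimage continuous_on_product_coordinates) auto
  then have "open (U \<inter> \<phi> -` B)"
    using continuous_open_preimage[OF ch(4,1)] by blast
  moreover have "a \<in> U \<inter> \<phi> -` B"
    using U(2) e(1) by (simp add: B_def)
  moreover have "path_component UNIV a x" if x: "x \<in> U \<inter> \<phi> -` B" for x
  proof -
    define \<gamma> where "\<gamma> t = (\<lambda>i. (1 - t) * \<phi> a i + t * \<phi> x i)" for t :: real
    have in_img: "\<gamma> t \<in> \<phi> ` U" if t: "t \<in> {0..1}" for t
    proof (rule e(2))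
      fix i
      show "\<gamma> t i = 0" if "mdim M \<le> i"
        using openin_Euclidean_space_zero[OF ch(2) imageI] U(2) x that by (simp add: \<gamma>_def)
      assume "i < mdim M"
      then have "\<bar>\<phi> x i - \<phi> a i\<bar> < e"
        using x by (auto simp: B_def dist_real_def abs_minus_commute)
      moreover have "\<gamma> t i - \<phi> a i = t * (\<phi> x i - \<phi> a i)"
        by (simp add: \<gamma>_def algebra_simps)
      moreover have "t * \<bar>\<phi> x i - \<phi> a i\<bar> \<le> \<bar>\<phi> x i - \<phi> a i\<bar>"
        using t by (simp add: mult_left_le_one_le)
      ultimately show "\<bar>\<gamma> t i - \<phi> a i\<bar> < e"
        using t by (simp add: abs_mult)
    qed
    have "continuous_on {0..1} \<gamma>"
      unfolding \<gamma>_def by (intro continuous_on_coordinatewise_then_product continuous_intros)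
    then have "path (inv_into U \<phi> \<circ> \<gamma>)"
      unfolding path_def using in_img
      by (intro continuous_on_compose continuous_on_subset[OF ch(5)]) auto
    moreover have "pathstart (inv_into U \<phi> \<circ> \<gamma>) = a" "pathfinish (inv_into U \<phi> \<circ> \<gamma>) = x"
      using inv_into_f_f[OF ch(3)] U(2) x by (simp_all add: pathstart_def pathfinish_def \<gamma>_def)
    ultimately show ?thesis
      unfolding path_component_def by blast
  qed
  ultimately show "\<exists>T. openin (top_of_set UNIV) T \<and> a \<in> T \<and> (\<forall>x\<in>T. path_component UNIV a x)"
    by (intro exI[of _ "U \<inter> \<phi> -` B"]) simp
qed (auto intro: path_component_sym path_component_trans)

text \<open>The lifting theorems for covering spaces in the library are restricted to normed spaces.\<close>

lemma covering_lift_interval: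
  fixes p :: "'c::topological_space \<Rightarrow> 'm::topological_space" and c :: "real \<Rightarrow> 'm"
  assumes cov: "covering_space UNIV p UNIV" and "a \<le> b" and c: "continuous_on {a..b} c" and "p y = c a"
  shows "\<exists>l. continuous_on {a..b} l \<and> l a = y \<and> (\<forall>t\<in>{a..b}. p (l t) = c t)"
proof -
  \<comment> \<open>The property is shaped for bisection. The starting point \<open>y\<close> is
    arbitrary, so that the lift over the second half can begin where the first one ends; inclusion
    in \<open>{a..b}\<close> is a premise, since small intervals about an endpoint may stick
    out.\<close>
  define P where "P u v \<longleftrightarrow> (\<forall>y. u \<le> v \<longrightarrow> {u..v} \<subseteq> {a..b} \<longrightarrow> p y = c u \<longrightarrow>
      (\<exists>l. continuous_on {u..v} l \<and> l u = y \<and> (\<forall>t\<in>{u..v}. p (l t) = c t)))" for u v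
  have "P a b"
    using \<open>a \<le> b\<close>
  proof (induction rule: Bolzano)
    case (trans u v w)
    show ?case
      unfolding P_def
    proof (intro allI impI)
      fix y assume y: "{u..w} \<subseteq> {a..b}" "p y = c u"
      have sub: "{u..v} \<subseteq> {a..b}" "{v..w} \<subseteq> {a..b}" using trans(3,4) y(1) by auto
      from trans(1)[unfolded P_def, rule_format, OF trans(3) sub(1) y(2)]
      obtain l where l: "continuous_on {u..v} l" "l u = y" "\<forall>t\<in>{u..v}. p (l t) = c t" by blast
      have "p (l v) = c v" using l(3) trans(3) by simp
      from trans(2)[unfolded P_def, rule_format, OF trans(4) sub(2) this]
      obtain l' where l': "continuous_on {v..w} l'" "l' v = l v" "\<forall>t\<in>{v..w}. p (l' t) = c t" by blast
      have "continuous_on ({u..v} \<union> {v..w}) (\<lambda>t. if t \<le> v then l t else l' t)"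
        using l(1) l'(1,2) by (intro continuous_on_cases) auto
      moreover have "{u..v} \<union> {v..w} = {u..w}" using trans by auto
      ultimately show "\<exists>l. continuous_on {u..w} l \<and> l u = y \<and> (\<forall>t\<in>{u..w}. p (l t) = c t)"
        using l l' trans by (intro exI[of _ "\<lambda>t. if t \<le> v then l t else l' t"]) auto
    qed
  next
    case (local x)
    obtain T \<V> where T: "c x \<in> T" "open T" "\<Union>\<V> = p -` T" "\<And>S. S \<in> \<V> \<Longrightarrow> \<exists>q. homeomorphism S T p q"
    proof -
      have "\<exists>T. c x \<in> T \<and> openin (top_of_set UNIV) T \<and> (\<exists>\<V>. \<Union>\<V> = UNIV \<inter> p -` T \<and>
          (\<forall>S\<in>\<V>. openin (top_of_set UNIV) S) \<and> pairwise disjnt \<V> \<and> (\<forall>S\<in>\<V>. \<exists>q. homeomorphism S T p q))"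
        using cov unfolding covering_space_def by blast
      then show thesis using that by auto
    qed
    obtain A where A: "open A" "A \<inter> {a..b} = c -` T \<inter> {a..b}"
      using c T(2) unfolding continuous_on_open_invariant by blast
    then have "x \<in> A" using T(1) local by auto
    then obtain d where d: "d > 0" "\<And>t. \<bar>t - x\<bar> < d \<Longrightarrow> t \<in> A"
      using A(1) unfolding open_dist dist_real_def by blast
    \<comment> \<open>On a short interval \<open>c\<close> stays in an evenly covered set, and the
      inverse of \<open>p\<close> on the sheet containing \<open>y\<close> gives the lift.\<close>
    have "P u v" if uv: "u \<le> x" "x \<le> v" "v - u < d" for u v
      unfolding P_def
    proof (intro allI impI)
      fix y assume y: "{u..v} \<subseteq> {a..b}" "p y = c u"
      have cT: "c t \<in> T" if "t \<in> {u..v}" for t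
        using d(2)[of t] that uv y(1) A(2) by (auto simp: abs_less_iff)
      then have "p y \<in> T" using y(2) uv by simp
      then have "y \<in> \<Union>\<V>" unfolding T(3) by simp
      then obtain S where S: "S \<in> \<V>" "y \<in> S" by blast
      then obtain q where q: "homeomorphism S T p q" using T(4) by blast
      have "continuous_on {u..v} (\<lambda>t. q (c t))"
        using continuous_on_compose2[OF homeomorphism_cont2[OF q] continuous_on_subset[OF c y(1)]] cT by blast
      moreover have "q (c u) = y" using homeomorphism_apply1[OF q S(2)] y(2) by simp
      moreover have "p (q (c t)) = c t" if "t \<in> {u..v}" for t
        using homeomorphism_apply2[OF q cT[OF that]] .
      ultimately show "\<exists>l. continuous_on {u..v} l \<and> l u = y \<and> (\<forall>t\<in>{u..v}. p (l t) = c t)"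
        by blast
    qed
    then show ?case using d(1) by blast
  qed
  then show ?thesis using assms unfolding P_def by blast
qed

text \<open>The set where the lifts agree is closed because the total space is Hausdorff, and open
  because \<open>p\<close> is injective near each point.\<close>

lemma covering_lift_unique:
  fixes p :: "'c::t2_space \<Rightarrow> 'm::topological_space" and l l' :: "real \<Rightarrow> 'c"
  assumes cov: "covering_space UNIV p UNIV" and S: "connected S" "a \<in> S" "l a = l' a"
    and l: "continuous_on S l" and l': "continuous_on S l'" and eq: "\<And>t. t \<in> S \<Longrightarrow> p (l t) = p (l' t)"
    and "t \<in> S"
  shows "l t = l' t"
proof -
  let ?E = "{t \<in> S. l t = l' t}"
  have "?E = S \<inter> (\<lambda>t. (l t, l' t)) -` {z. fst z = snd z}" by auto
  moreover have "closed {z::'c \<times> 'c. fst z = snd z}"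
    using closed_diagonal[where 'a='c] by (rule back_subst[of closed]) auto
  note continuous_closedin_preimage[OF continuous_on_Pair[OF l l'] this]
  ultimately have "closedin (top_of_set S) ?E"
    by simp
  moreover have "openin (top_of_set S) ?E"
  proof (subst openin_subopen, intro ballI)
    fix s assume s: "s \<in> ?E"
    obtain W u q where "l s \<in> W" "openin (top_of_set UNIV) W" "homeomorphism W u p q"
      using covering_space_local_homeomorphism[OF cov UNIV_I] by metis
    then have W: "l s \<in> W" "open W" "inj_on p W"
      unfolding homeomorphism_def by (auto intro: inj_on_inverseI)
    have "openin (top_of_set S) (S \<inter> (\<lambda>t. (l t, l' t)) -` (W \<times> W))"
      using continuous_openin_preimage_gen[OF continuous_on_Pair[OF l l'] open_Times[OF W(2,2)]] .
    moreover have "S \<inter> (\<lambda>t. (l t, l' t)) -` (W \<times> W) \<subseteq> ?E"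
      using eq W(3) by (auto dest: inj_onD)
    ultimately show "\<exists>T. openin (top_of_set S) T \<and> s \<in> T \<and> T \<subseteq> ?E"
      using s W(1) by (intro exI[of _ "S \<inter> (\<lambda>t. (l t, l' t)) -` (W \<times> W)"]) auto
  qed
  ultimately have "?E = {} \<or> ?E = S"
    using S(1) unfolding connected_clopen by blast
  then show ?thesis using S(2,3) \<open>t \<in> S\<close> by blast
qed

text \<open>Lifts over the compact intervals from \<open>-n\<close> to \<open>n\<close> with the
  same value at 0 extend one another by uniqueness, so they fit together on the line.\<close>

lemma covering_lift_real:
  fixes p :: "'c::t2_space \<Rightarrow> 'm::topological_space" and c :: "real \<Rightarrow> 'm"
  assumes cov: "covering_space UNIV p UNIV" and c: "continuous_on UNIV c" and y: "p y = c 0"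
  obtains l where "continuous_on UNIV l" "l 0 = y" "\<And>t. p (l t) = c t"
proof -
  have "\<exists>l. continuous_on {-real n..real n} l \<and> l 0 = y \<and> (\<forall>t\<in>{-real n..real n}. p (l t) = c t)" for n
  proof -
    obtain r where r: "continuous_on {0..real n} r" "r 0 = y" "\<And>t. t \<in> {0..real n} \<Longrightarrow> p (r t) = c t"
      using covering_lift_interval[OF cov, of 0 "real n" c y] continuous_on_subset[OF c subset_UNIV] y by auto
    \<comment> \<open>The negative half is lifted by reversing time, because
      \<open>covering_lift_interval\<close> prescribes the value at the left end.\<close>
    have "continuous_on {0..real n} (\<lambda>t. c (- t))"
      by (intro continuous_on_compose2[OF c] continuous_intros) auto
    then obtain s where s: "continuous_on {0..real n} s" "s 0 = y" "\<And>t. t \<in> {0..real n} \<Longrightarrow> p (s t) = c (- t)"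
      using covering_lift_interval[OF cov, of 0 "real n" "\<lambda>t. c (- t)" y] y by auto
    have "continuous_on {-real n..0} (\<lambda>t. s (- t))"
      by (intro continuous_on_compose2[OF s(1)] continuous_intros) auto
    then have "continuous_on ({-real n..0} \<union> {0..real n}) (\<lambda>t. if t \<le> 0 then s (- t) else r t)"
      using r(1,2) s(2) by (intro continuous_on_cases) auto
    moreover have "{-real n..0} \<union> {0..real n} = {-real n..real n}" by auto
    ultimately show ?thesis
      using r s by (intro exI[of _ "\<lambda>t. if t \<le> 0 then s (- t) else r t"]) auto
  qed
  then obtain l where l: "\<And>n. continuous_on {-real n..real n} (l n)" "\<And>n. l n 0 = y"
    "\<And>n t. t \<in> {-real n..real n} \<Longrightarrow> p (l n t) = c t"
    by metis
  \<comment> \<open>At \<open>t\<close> the smallest symmetric interval with natural endpoints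
    containing \<open>t\<close> is used; any larger one gives the same value.\<close>
  define L where "L t = l (nat \<lceil>\<bar>t\<bar>\<rceil>) t" for t
  have L: "L t = l n t" if t: "t \<in> {-real n..real n}" for t n
  proof -
    define m where "m = nat \<lceil>\<bar>t\<bar>\<rceil>"
    have "\<bar>t\<bar> \<le> real n" using t by auto
    then have mn: "m \<le> n" by (simp add: m_def ceiling_le_iff nat_le_iff)
    have tm: "t \<in> {-real m..real m}"
      using real_nat_ceiling_ge[of "\<bar>t\<bar>"] unfolding m_def atLeastAtMost_iff by linarith
    have "{-real m..real m} \<subseteq> {-real n..real n}" using mn by auto
    note sub = continuous_on_subset[OF l(1) this]
    show ?thesis
      unfolding L_def m_def[symmetric]
      by (rule covering_lift_unique[OF cov, where S = "{-real m..real m}" and a = 0])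
        (use l sub tm mn in auto)
  qed
  have "continuous_on UNIV L"
  proof (rule continuous_on_local)
    fix x :: real
    obtain n where n: "\<bar>x\<bar> < real n" using reals_Archimedean2 by blast
    have "continuous_on {-real n<..<real n} (l n)"
      by (rule continuous_on_subset[OF l(1)]) auto
    then have "continuous_on {-real n<..<real n} L"
      by (rule continuous_on_eq) (rule L[symmetric], simp)
    then show "\<exists>V. openin (top_of_set UNIV) V \<and> x \<in> V \<and> continuous_on V L"
      using n by (intro exI[of _ "{-real n<..<real n}"]) auto
  qed
  moreover have "L 0 = y" by (simp add: L_def l(2))
  moreover have "p (L t) = c t" for t
  proof -
    obtain n where "\<bar>t\<bar> < real n" using reals_Archimedean2 by blast
    then have "t \<in> {-real n..real n}" by auto
    then show ?thesis using L l(3) by simp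
  qed
  ultimately show thesis by (rule that)
qed

section \<open>Smooth lifts through local diffeomorphisms\<close>

text \<open>Continuity keeps \<open>l\<close> inside one \<open>W\<close> near each point, and there
  \<open>l\<close> is the smooth inverse branch of \<open>p\<close> applied to
  \<open>c\<close>.\<close>

lemma smooth_into_lift:
  assumes Mt: "charted Mt" and M: "charted M"
    and diffeo: "\<And>x. \<exists>W. x \<in> W \<and> diffeomorphism_on W (p ` W) Mt M p"
    and c: "smooth_into M n U c" and l: "continuous_on U l" and pl: "\<And>x. x \<in> U \<Longrightarrow> p (l x) = c x"
  shows "smooth_into Mt n U l"
proof (rule smooth_into_local[OF Mt])
  show U: "openin (Euclidean_space n) U" using smooth_intoD(1)[OF c] .
  fix x assume x: "x \<in> U"
  obtain W where W: "l x \<in> W" "diffeomorphism_on W (p ` W) Mt M p" using diffeo by blast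
  then have W': "open W" "open (p ` W)" "inj_on p W" "smooth_map_on (p ` W) M Mt (inv_into W p)"
    unfolding diffeomorphism_on_def bij_betw_def by auto
  let ?V = "U \<inter> l -` W"
  have V: "openin (Euclidean_space n) ?V"
    using openin_Euclidean_space_preimage[OF U l W'(1)] .
  have "smooth_into Mt n ?V (\<lambda>x. inv_into W p (c x))"
  proof (rule smooth_into_compose[OF M Mt _ W'(4,2)])
    show "smooth_into M n ?V c" using smooth_into_subset[OF c V] by blast
    show "c x \<in> p ` W" if "x \<in> ?V" for x using pl[of x] that by (metis IntE imageI vimageE)
  qed
  then have "smooth_into Mt n ?V l"
    by (rule smooth_into_cong[OF Mt]) (use pl W'(3) in \<open>auto simp flip: pl\<close>)
  then show "\<exists>V. x \<in> V \<and> V \<subseteq> U \<and> smooth_into Mt n V l"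
    using x W(1) by (intro exI[of _ ?V]) auto
qed

text \<open>The domain of a plot can have topology that obstructs a global lift. The quotient
  diffeology asks only for local ones, which an inverse branch of \<open>p\<close> provides.\<close>

lemma smooth_into_local_lift:
  assumes Mt: "charted Mt" and M: "charted M" and p: "surj p"
    and diffeo: "\<And>x. \<exists>W. x \<in> W \<and> diffeomorphism_on W (p ` W) Mt M p"
    and c: "smooth_into M n U c" and x: "x \<in> U"
  obtains V l where "x \<in> V" "V \<subseteq> U" "smooth_into Mt n V l" "\<And>y. y \<in> V \<Longrightarrow> p (l y) = c y"
proof -
  obtain z where z: "p z = c x" using p by (metis surjD)
  obtain W where W: "z \<in> W" "diffeomorphism_on W (p ` W) Mt M p" using diffeo by blast
  then have W': "open (p ` W)" "smooth_map_on (p ` W) M Mt (inv_into W p)"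
    unfolding diffeomorphism_on_def by auto
  let ?V = "U \<inter> c -` (p ` W)"
  have V: "openin (Euclidean_space n) ?V"
    using openin_Euclidean_space_preimage[OF smooth_intoD(1,2)[OF c] W'(1)] .
  show thesis
  proof (rule that[of ?V "\<lambda>y. inv_into W p (c y)"])
    show "x \<in> ?V" using x z W(1) by (metis IntI imageI vimageI)
    show "smooth_into Mt n ?V (\<lambda>y. inv_into W p (c y))"
      by (rule smooth_into_compose[OF M Mt smooth_into_subset[OF c V] W'(2,1)]) auto
  qed (auto simp: f_inv_into_f)
qed

lemma smooth_map_local_diffeomorphism:
  assumes "charted Mt" "charted M" "\<And>x. \<exists>W. x \<in> W \<and> diffeomorphism_on W (p ` W) Mt M p"
  shows "smooth_map Mt M p"
proof (rule smooth_map_local[OF assms(1,2)])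
  show "\<exists>W. x \<in> W \<and> open W \<and> smooth_map_on W Mt M p" for x
    using assms(3)[of x] unfolding diffeomorphism_on_def by blast
qed

text \<open>Velocities are 0 by convention off the smooth functions. Pushing one forward evaluates
  it at \<open>f\<close> \<circ> \<open>p\<close>, so the identity depends on this function being
  smooth whenever \<open>f\<close> is.\<close>

lemma pullback_velocity:
  assumes "smooth_manifold Mt" "charted M" "smooth_map Mt M p"
  shows "pullback M p \<omega> (l t) (velocity Mt l t) = \<omega> (p (l t)) (velocity M (p \<circ> l) t)"
proof -
  have "push_forward M p (velocity Mt l t) = velocity M (p \<circ> l) t"
    unfolding push_forward_def velocity_def
    using smooth_functions_pullback[OF assms] by (auto simp: fun_eq_iff o_assoc)
  then show ?thesis unfolding pullback_def by simp
qed

lemma smooth_curve_imp_continuous: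
  assumes "smooth_curve M c" shows "continuous_on UNIV c"
proof -
  have "continuous_on (topspace (Euclidean_space 1)) (\<lambda>x. c (x 0))"
    using smooth_intoD(2) assms unfolding smooth_curve_def by blast
  \<comment> \<open>This is the embedding of the line into \<open>Euclidean_space 1\<close>, along
    which \<open>smooth_curve\<close> is turned back into a statement on real parameters.\<close>
  moreover have "continuous_on UNIV (\<lambda>t (i::nat). if i = 0 then t else 0 :: real)"
  proof (rule continuous_on_coordinatewise_then_product)
    fix i :: nat show "continuous_on UNIV (\<lambda>t. if i = 0 then t else 0 :: real)"
      by (cases "i = 0") auto
  qed
  ultimately have "continuous_on UNIV (\<lambda>t. c (if (0::nat) = 0 then t else 0))"
    by (rule continuous_on_compose2) (auto simp: topspace_Euclidean_space)
  then show ?thesis by simp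
qed

text \<open>A tangent arc in \<open>M\<close> lifts from any prescribed point over its start, so a
  chain of arcs is lifted arc by arc, each beginning where the previous lift ended. Tangency passes
  both ways by \<open>pullback_velocity\<close>.\<close>

lemma leaf_covering_image:
  fixes Mt :: "'c::{t2_space, second_countable_topology} smooth_structure"
    and M :: "'m::{t2_space, second_countable_topology} smooth_structure"
  assumes Mt: "smooth_manifold Mt" and M: "charted M" and cov: "covering_space UNIV p UNIV"
    and diffeo: "\<And>x. \<exists>W. x \<in> W \<and> diffeomorphism_on W (p ` W) Mt M p"
  shows "leaf M \<omega> (p y) = p ` leaf Mt (pullback M p \<omega>) y"
proof -
  note Mt' = smooth_manifold_imp_charted[OF Mt]
  note p = smooth_map_local_diffeomorphism[OF Mt' M diffeo]
  have down: "tangent_arc M \<omega> (p a) (p b)" if ab: "tangent_arc Mt (pullback M p \<omega>) a b" for a b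
  proof -
    obtain c where c: "smooth_curve Mt c" "c 0 = a" "c 1 = b"
      "\<And>t. pullback M p \<omega> (c t) (velocity Mt c t) = 0"
      using ab unfolding tangent_arc_def by blast
    have "smooth_curve M (p \<circ> c)"
      using smooth_into_compose[OF Mt' M _ p open_UNIV UNIV_I] c(1) unfolding smooth_curve_def by auto
    moreover have "\<omega> ((p \<circ> c) t) (velocity M (p \<circ> c) t) = 0" for t
      using c(4)[of t] pullback_velocity[OF Mt M p, of \<omega> c t] by simp
    ultimately show ?thesis
      unfolding tangent_arc_def using c(2,3) by (intro exI[of _ "p \<circ> c"]) auto
  qed
  have up: "\<exists>b. p b = z \<and> tangent_arc Mt (pullback M p \<omega>) a b" if az: "tangent_arc M \<omega> (p a) z" for a z
  proof -
    obtain c where c: "smooth_curve M c" "c 0 = p a" "c 1 = z" "\<And>t. \<omega> (c t) (velocity M c t) = 0"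
      using az unfolding tangent_arc_def by blast
    obtain l where l: "continuous_on UNIV l" "l 0 = a" "\<And>t. p (l t) = c t"
      using covering_lift_real[OF cov smooth_curve_imp_continuous[OF c(1)] c(2)[symmetric]] by blast
    have "continuous_on (topspace (Euclidean_space 1)) (\<lambda>x. l (x 0))"
      by (intro continuous_on_compose2[OF l(1)] continuous_on_subset[OF continuous_on_product_coordinates]) auto
    then have "smooth_curve Mt l"
      using smooth_into_lift[OF Mt' M diffeo] c(1) l(3) unfolding smooth_curve_def by blast
    moreover have "p \<circ> l = c" using l(3) by auto
    then have "pullback M p \<omega> (l t) (velocity Mt l t) = 0" for t
      using pullback_velocity[OF Mt M p, of \<omega> l t] c(4)[of t] l(3) by simp
    ultimately have "tangent_arc Mt (pullback M p \<omega>) a (l 1)"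
      unfolding tangent_arc_def using l(2) by blast
    then show ?thesis using l(3) c(3) by blast
  qed
  have "(tangent_arc M \<omega>)\<^sup>*\<^sup>* (p y) (p b)" if "(tangent_arc Mt (pullback M p \<omega>))\<^sup>*\<^sup>* y b" for b
    using that by induction (auto intro: rtranclp.rtrancl_into_rtrancl down)
  moreover have "\<exists>b. p b = z \<and> (tangent_arc Mt (pullback M p \<omega>))\<^sup>*\<^sup>* y b"
    if "(tangent_arc M \<omega>)\<^sup>*\<^sup>* (p y) z" for z
    using that
  proof induction
    case (step u v)
    then obtain a where a: "p a = u" "(tangent_arc Mt (pullback M p \<omega>))\<^sup>*\<^sup>* y a" by blast
    then obtain b where "p b = v" "tangent_arc Mt (pullback M p \<omega>) a b" using up step(2) by blast
    then show ?case using a(2) by (blast intro: rtranclp.rtrancl_into_rtrancl)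
  qed blast
  ultimately show ?thesis
    unfolding leaf_def by blast
qed

section \<open>Diffeomorphism groups of quotients\<close>

lemma carrier_Diff_group:
  "carrier (Diff_group X P) = {f \<in> Bij X. differentiable_map P P f \<and> differentiable_map P P (inv_into X f)}"
  by (simp add: Diff_group_def)

lemma mult_Diff_group:
  assumes "f \<in> Bij X" "g \<in> Bij X"
  shows "f \<otimes>\<^bsub>Diff_group X P\<^esub> g = compose X f g"
  using assms by (simp add: Diff_group_def BijGroup_def)

lemma BijD:
  assumes "f \<in> Bij X"
  shows "x \<in> X \<Longrightarrow> f x \<in> X" "x \<in> X \<Longrightarrow> inv_into X f x \<in> X"
    "x \<in> X \<Longrightarrow> f (inv_into X f x) = x" "x \<in> X \<Longrightarrow> inv_into X f (f x) = x"
  using assms Bij_imp_funcset[OF assms] Bij_inv_into_mem[OF assms]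
  by (auto simp: Bij_def bij_betw_def f_inv_into_f)

text \<open>These two closure properties make differentiability of a map depend on its values on
  \<open>X\<close> alone. That matters because elements of \<open>Diff_group\<close> are
  extensional, so a conjugate has to be cut down to its set.\<close>

definition diffeology_on :: "'q set \<Rightarrow> 'q diffeology \<Rightarrow> bool" where
  "diffeology_on X P \<longleftrightarrow> (\<forall>n U c. P n U c \<longrightarrow> c ` U \<subseteq> X) \<and>
     (\<forall>n U c d. P n U c \<longrightarrow> (\<forall>u\<in>U. c u = d u) \<longrightarrow> P n U d)"

lemma differentiable_map_cong:
  assumes P: "diffeology_on X P" and Q: "diffeology_on Y Q" and f: "differentiable_map P Q f"
    and eq: "\<And>x. x \<in> X \<Longrightarrow> f x = g x"
  shows "differentiable_map P Q g"
  unfolding differentiable_map_def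
proof (intro allI impI)
  fix n U c assume c: "P n U c"
  then have "\<forall>u\<in>U. (f \<circ> c) u = (g \<circ> c) u"
    using P eq unfolding diffeology_on_def by (metis comp_apply image_subset_iff)
  moreover have "Q n U (f \<circ> c)"
    using c f unfolding differentiable_map_def by blast
  ultimately show "Q n U (g \<circ> c)"
    using Q unfolding diffeology_on_def by blast
qed

lemma differentiable_map_comp:
  "differentiable_map P Q f \<Longrightarrow> differentiable_map Q R g \<Longrightarrow> differentiable_map P R (g \<circ> f)"
  unfolding differentiable_map_def by (metis comp_assoc)

text \<open>The hypotheses are symmetric in \<Phi> and \<Psi>, so exchanging them yields the
  membership needed for the inverse isomorphism.\<close>

lemma conjugate_in_Diff_group:
  assumes PQ: "diffeology_on X P" "diffeology_on Y Q"
    and \<Phi>: "\<And>x. x \<in> X \<Longrightarrow> \<Phi> x \<in> Y" "\<And>x. x \<in> X \<Longrightarrow> \<Psi> (\<Phi> x) = x" "differentiable_map P Q \<Phi>"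
    and \<Psi>: "\<And>y. y \<in> Y \<Longrightarrow> \<Psi> y \<in> X" "\<And>y. y \<in> Y \<Longrightarrow> \<Phi> (\<Psi> y) = y" "differentiable_map Q P \<Psi>"
    and f: "f \<in> carrier (Diff_group X P)"
  shows "(\<lambda>y\<in>Y. \<Phi> (f (\<Psi> y))) \<in> carrier (Diff_group Y Q)"
proof -
  let ?F = "\<lambda>y\<in>Y. \<Phi> (f (\<Psi> y))"
  have fX: "f \<in> Bij X" and fd: "differentiable_map P P f" "differentiable_map P P (inv_into X f)"
    using f by (auto simp: carrier_Diff_group)
  note fB = BijD[OF fX]
  have bij: "bij_betw ?F Y Y"
    by (rule bij_betw_byWitness[where f' = "\<lambda>y. \<Phi> (inv_into X f (\<Psi> y))"]) (use \<Phi> \<Psi> fB in auto)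
  then have F: "?F \<in> Bij Y" by (simp add: Bij_def)
  \<comment> \<open>The inverse of a conjugate is the conjugate of the inverse; the two functions
    are compared on \<open>Y\<close> only, which is all that differentiability sees.\<close>
  have inv: "\<Phi> (inv_into X f (\<Psi> y)) = inv_into Y ?F y" if "y \<in> Y" for y
    using that bij \<Phi> \<Psi> fB by (intro inv_into_f_eq[symmetric]) (auto simp: bij_betw_def)
  have "differentiable_map Q Q (\<Phi> \<circ> (f \<circ> \<Psi>))" "differentiable_map Q Q (\<Phi> \<circ> (inv_into X f \<circ> \<Psi>))"
    by (intro differentiable_map_comp[OF _ \<Phi>(3)] differentiable_map_comp[OF \<Psi>(3)] fd)+
  note d = this
  have "differentiable_map Q Q ?F"
    by (rule differentiable_map_cong[OF PQ(2,2) d(1)]) simp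
  moreover have "differentiable_map Q Q (inv_into Y ?F)"
    by (rule differentiable_map_cong[OF PQ(2,2) d(2)]) (simp add: inv)
  ultimately show ?thesis using F by (simp add: carrier_Diff_group)
qed

lemma Diff_group_iso:
  assumes PQ: "diffeology_on X P" "diffeology_on Y Q"
    and \<Phi>: "\<And>x. x \<in> X \<Longrightarrow> \<Phi> x \<in> Y" "\<And>x. x \<in> X \<Longrightarrow> \<Psi> (\<Phi> x) = x" "differentiable_map P Q \<Phi>"
    and \<Psi>: "\<And>y. y \<in> Y \<Longrightarrow> \<Psi> y \<in> X" "\<And>y. y \<in> Y \<Longrightarrow> \<Phi> (\<Psi> y) = y" "differentiable_map Q P \<Psi>"
  shows "Diff_group X P \<cong> Diff_group Y Q"
proof -
  let ?F = "\<lambda>f. \<lambda>y\<in>Y. \<Phi> (f (\<Psi> y))" and ?G = "\<lambda>g. \<lambda>x\<in>X. \<Psi> (g (\<Phi> x))"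
  have F: "?F f \<in> carrier (Diff_group Y Q)" if "f \<in> carrier (Diff_group X P)" for f
    using conjugate_in_Diff_group[of X P Y Q \<Phi> \<Psi>, OF PQ \<Phi> \<Psi> that] .
  have G: "?G g \<in> carrier (Diff_group X P)" if "g \<in> carrier (Diff_group Y Q)" for g
    using conjugate_in_Diff_group[of Y Q X P \<Psi> \<Phi>, OF PQ(2,1) \<Psi> \<Phi> that] .
  have Bij: "f \<in> Bij X" if "f \<in> carrier (Diff_group X P)" for f X and P :: "'z diffeology"
    using that by (simp add: carrier_Diff_group)
  \<comment> \<open>Extensionality of the elements of \<open>Bij\<close> upgrades agreement on the
    underlying set to equality of functions.\<close>
  have GF: "?G (?F f) = f" if "f \<in> carrier (Diff_group X P)" for f
    using \<Phi> BijD(1)[OF Bij[OF that]] Bij_imp_extensional[OF Bij[OF that]]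
    by (auto simp: fun_eq_iff extensional_def)
  have FG: "?F (?G g) = g" if "g \<in> carrier (Diff_group Y Q)" for g
    using \<Psi> BijD(1)[OF Bij[OF that]] Bij_imp_extensional[OF Bij[OF that]]
    by (auto simp: fun_eq_iff extensional_def)
  have "bij_betw ?F (carrier (Diff_group X P)) (carrier (Diff_group Y Q))"
    using F G GF FG by (intro bij_betw_byWitness[where f' = ?G]) blast+
  moreover have "?F \<in> hom (Diff_group X P) (Diff_group Y Q)"
  proof (rule homI)
    fix f g assume fg: "f \<in> carrier (Diff_group X P)" "g \<in> carrier (Diff_group X P)"
    have "?F (compose X f g) = compose Y (?F f) (?F g)"
      using \<Phi> \<Psi> BijD(1)[OF Bij[OF fg(2)]] by (auto simp: compose_def fun_eq_iff)
    then show "?F (f \<otimes>\<^bsub>Diff_group X P\<^esub> g) = ?F f \<otimes>\<^bsub>Diff_group Y Q\<^esub> ?F g"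
      using mult_Diff_group[OF Bij[OF fg(1)] Bij[OF fg(2)]]
        mult_Diff_group[OF Bij[OF F[OF fg(1)]] Bij[OF F[OF fg(2)]]] by simp
  qed (rule F)
  ultimately show ?thesis
    unfolding is_iso_def iso_def by blast
qed

section \<open>Plots of quotients\<close>

lemma diffeology_on_quotient: "diffeology_on (range \<pi>) (quotient_diffeology M \<pi>)"
  unfolding diffeology_on_def
proof (intro conjI allI impI subsetI)
  fix n U c q assume c: "quotient_diffeology M \<pi> n U c" "q \<in> c ` U"
  then obtain u where u: "u \<in> U" "q = c u" by blast
  from c(1) u(1) obtain V s where "u \<in> V" "\<forall>v\<in>V. \<pi> (s v) = c v"
    unfolding quotient_diffeology_def by blast
  then show "q \<in> range \<pi>" using u(2) by (metis rangeI)
next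
  fix n U c d assume c: "quotient_diffeology M \<pi> n U c" and eq: "\<forall>u\<in>U. c u = d u"
  show "quotient_diffeology M \<pi> n U d"
    unfolding quotient_diffeology_def
  proof (intro conjI ballI)
    show "openin (Euclidean_space n) U" using c unfolding quotient_diffeology_def by blast
    fix u assume "u \<in> U"
    then obtain V s where V: "u \<in> V" "V \<subseteq> U" "smooth_into M n V s" "\<forall>v\<in>V. \<pi> (s v) = c v"
      using c unfolding quotient_diffeology_def by blast
    then have "\<forall>v\<in>V. \<pi> (s v) = d v" using eq by auto
    then show "\<exists>V s. u \<in> V \<and> V \<subseteq> U \<and> smooth_into M n V s \<and> (\<forall>v\<in>V. \<pi> (s v) = d v)"
      using V by blast
  qed
qed

text \<open>Plots of the source lift locally by definition, so only plots of the form \<pi> \<circ>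
  \<open>s\<close> with \<open>s\<close> smooth have to be tested, and only near a given
  point.\<close>

lemma differentiable_map_quotient:
  assumes "\<And>n U s u. smooth_into M n U s \<Longrightarrow> u \<in> U \<Longrightarrow>
      \<exists>V t. u \<in> V \<and> V \<subseteq> U \<and> smooth_into N n V t \<and> (\<forall>v\<in>V. \<rho> (t v) = f (\<pi> (s v)))"
  shows "differentiable_map (quotient_diffeology M \<pi>) (quotient_diffeology N \<rho>) f"
  unfolding differentiable_map_def
proof (intro allI impI)
  fix n U c assume c: "quotient_diffeology M \<pi> n U c"
  show "quotient_diffeology N \<rho> n U (f \<circ> c)"
    unfolding quotient_diffeology_def
  proof (intro conjI ballI)
    show "openin (Euclidean_space n) U" using c unfolding quotient_diffeology_def by blast
    fix u assume "u \<in> U"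
    then obtain V s where V: "u \<in> V" "V \<subseteq> U" "smooth_into M n V s" "\<forall>v\<in>V. \<pi> (s v) = c v"
      using c unfolding quotient_diffeology_def by blast
    obtain W t where W: "u \<in> W" "W \<subseteq> V" "smooth_into N n W t" "\<forall>v\<in>W. \<rho> (t v) = f (\<pi> (s v))"
      using assms[OF V(3,1)] by blast
    then have "\<forall>v\<in>W. \<rho> (t v) = (f \<circ> c) v" using V(4) by auto
    then show "\<exists>V s. u \<in> V \<and> V \<subseteq> U \<and> smooth_into N n V s \<and> (\<forall>v\<in>V. \<rho> (s v) = (f \<circ> c) v)"
      using W V(2) by blast
  qed
qed

section \<open>Developments\<close>

lemma locally_trivial_bundle_surj:
  assumes "locally_trivial_bundle E N F D"
  shows "surj D"
proof -
  have "\<exists>x. D x = g" for g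
  proof -
    obtain V and \<theta> :: "'a \<Rightarrow> 'c" where V: "g \<in> V" "bij_betw (\<lambda>x. (D x, \<theta> x)) (D -` V) (V \<times> UNIV)"
      using assms unfolding locally_trivial_bundle_def diffeomorphism_on_def by blast
    \<comment> \<open>The fibre is a whole type, hence nonempty; \<open>undefined\<close> serves as
      a point of it.\<close>
    then have "(g, undefined) \<in> (\<lambda>x. (D x, \<theta> x)) ` (D -` V)"
      unfolding bij_betw_def by simp
    then show ?thesis by auto
  qed
  then show ?thesis by (metis surjI)
qed

text \<open>The plot \<open>k\<close> is followed by the inverse of a trivialisation, with the fibre
  coordinate held at the arbitrary point \<open>undefined\<close>.\<close>

lemma locally_trivial_bundle_local_section:
  fixes F :: "'f::topological_space smooth_structure"
  assumes E: "charted E" and N: "charted N" and F: "charted F" and D: "locally_trivial_bundle E N F D"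
    and k: "smooth_into N n U k" and u: "u \<in> U"
  obtains V s where "u \<in> V" "V \<subseteq> U" "smooth_into E n V s" "\<And>v. v \<in> V \<Longrightarrow> D (s v) = k v"
proof -
  obtain A \<theta> where A: "k u \<in> A" "open A"
    and diffeo: "diffeomorphism_on (D -` A) (A \<times> UNIV) E (prod_structure N F) (\<lambda>x. (D x, \<theta> x))"
    using D unfolding locally_trivial_bundle_def by blast
  let ?\<theta> = "\<lambda>x. (D x, \<theta> x)" and ?V = "U \<inter> k -` A"
  let ?s = "inv_into (D -` A) ?\<theta>"
  have V: "openin (Euclidean_space n) ?V"
    using openin_Euclidean_space_preimage[OF smooth_intoD(1,2)[OF k] A(2)] .
  have s: "smooth_map_on (A \<times> UNIV) (prod_structure N F) E ?s" "open (A \<times> (UNIV :: 'f set))"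
    and im: "?\<theta> ` (D -` A) = A \<times> UNIV"
    using diffeo unfolding diffeomorphism_on_def bij_betw_def by auto
  have "smooth_into N n ?V k" using smooth_into_subset[OF k V] by blast
  from smooth_into_compose[OF charted_prod_structure[OF N F] E smooth_into_Pair_const[OF this] s]
  have "smooth_into E n ?V (\<lambda>v. ?s (k v, undefined))" by auto
  moreover have "D (?s (k v, undefined)) = k v" if "v \<in> ?V" for v
  proof -
    have "(k v, undefined) \<in> ?\<theta> ` (D -` A)" unfolding im using that by auto
    from f_inv_into_f[OF this] show ?thesis by auto
  qed
  ultimately show thesis
    using A(1) u by (intro that[of ?V "\<lambda>v. ?s (k v, undefined)"]) auto
qed

section \<open>Deck transformations and holonomy\<close>

lemma deck_transformations_id: "id \<in> deck_transformations p"
  unfolding deck_transformations_def using homeomorphism_ident by (auto simp: id_def)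

lemma deck_transformations_comp:
  "\<sigma> \<in> deck_transformations p \<Longrightarrow> \<tau> \<in> deck_transformations p \<Longrightarrow> \<sigma> \<circ> \<tau> \<in> deck_transformations p"
  unfolding deck_transformations_def by (auto simp: comp_assoc[symmetric] intro: homeomorphism_compose)

lemma deck_transformations_inverse:
  assumes "\<tau> \<in> deck_transformations p"
  obtains \<tau>' where "\<tau>' \<in> deck_transformations p" "\<And>x. \<tau> (\<tau>' x) = x"
proof -
  obtain \<tau>' where \<tau>': "homeomorphism UNIV UNIV \<tau> \<tau>'" and p: "p \<circ> \<tau> = p"
    using assms unfolding deck_transformations_def by blast
  have inv: "\<tau> (\<tau>' x) = x" for x using homeomorphism_apply2[OF \<tau>'] by simp
  have "p (\<tau>' x) = p x" for x
    using fun_cong[OF p, of "\<tau>' x"] inv by simp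
  then have "\<tau>' \<in> deck_transformations p"
    using homeomorphism_symD[OF \<tau>'] unfolding deck_transformations_def by (auto simp: fun_eq_iff)
  then show thesis using inv by (rule that)
qed

text \<open>From \<tau> to \<open>a\<close>: \<open>Mt\<close> is path connected, so some path leads
  from \<open>xt0\<close> to \<tau> \<open>xt0\<close>, and it projects to a loop. From
  \<open>a\<close> to \<tau>: a loop representing \<open>a\<close> lifts to a path from
  \<open>xt0\<close>, and regularity moves \<open>xt0\<close> to its endpoint, which lies over
  \<open>x0\<close>.\<close>

lemma holonomy_group_deck:
  fixes p :: "'c::{t2_space, second_countable_topology} \<Rightarrow> 'm::{t2_space, second_countable_topology}"
    and G :: "'a::{t2_space, second_countable_topology} monoid"
  assumes dev: "development M \<omega> N G Mt p F D x0 xt0 h" and G: "group G" "carrier G = UNIV"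
  shows "\<tau> \<in> deck_transformations p \<Longrightarrow> \<exists>a\<in>holonomy_group x0 h. \<forall>x. D (\<tau> x) = a \<otimes>\<^bsub>G\<^esub> D x"
    and "a \<in> holonomy_group x0 h \<Longrightarrow> \<exists>\<tau>\<in>deck_transformations p. \<forall>x. D (\<tau> x) = a \<otimes>\<^bsub>G\<^esub> D x"
proof -
  have Mt: "smooth_manifold Mt" and reg: "regular_covering Mt M p" and x0: "p xt0 = x0"
    and hol: "\<And>\<gamma> \<tau> x. path \<gamma> \<Longrightarrow> pathstart \<gamma> = xt0 \<Longrightarrow> p \<circ> \<gamma> \<in> loops_at x0 \<Longrightarrow>
        \<tau> \<in> deck_transformations p \<Longrightarrow> \<tau> xt0 = pathfinish \<gamma> \<Longrightarrow>
        D (\<tau> x) = h (homotopy_class (p \<circ> \<gamma>)) \<otimes>\<^bsub>G\<^esub> D x"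
    using dev unfolding development_def by auto
  have conn: "connected (UNIV :: 'c set)" and cov: "covering_space UNIV p UNIV"
    and trans: "\<And>x y. p x = p y \<Longrightarrow> \<exists>\<tau>\<in>deck_transformations p. \<tau> x = y"
    using reg unfolding regular_covering_def by auto
  have contp: "continuous_on UNIV p" using covering_space_imp_continuous[OF cov] .
  have loop: "p \<circ> \<gamma> \<in> loops_at x0" if "path \<gamma>" "pathstart \<gamma> = xt0" "p (pathfinish \<gamma>) = x0" for \<gamma>
    using that x0 path_continuous_image[OF that(1) continuous_on_subset[OF contp subset_UNIV]]
    by (simp add: loops_at_def pathstart_compose pathfinish_compose)
  have carr: "carrier (fundamental_group x0) = homotopy_class ` loops_at x0"
    by (simp add: fundamental_group_def)
  show "\<exists>a\<in>holonomy_group x0 h. \<forall>x. D (\<tau> x) = a \<otimes>\<^bsub>G\<^esub> D x" if \<tau>: "\<tau> \<in> deck_transformations p"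
  proof -
    obtain \<gamma> where \<gamma>: "path \<gamma>" "pathstart \<gamma> = xt0" "pathfinish \<gamma> = \<tau> xt0"
      using path_component_charted[OF smooth_manifold_imp_charted[OF Mt] conn]
      unfolding path_component_def by blast
    have "p (\<tau> xt0) = x0"
      using \<tau> x0 unfolding deck_transformations_def by (auto simp: fun_eq_iff)
    then have l: "p \<circ> \<gamma> \<in> loops_at x0" using loop \<gamma> by simp
    show ?thesis
      using hol[OF \<gamma>(1,2) l \<tau>] \<gamma>(3) l unfolding carr by (intro bexI[of _ "h (homotopy_class (p \<circ> \<gamma>))"]) auto
  qed
  show "\<exists>\<tau>\<in>deck_transformations p. \<forall>x. D (\<tau> x) = a \<otimes>\<^bsub>G\<^esub> D x" if a: "a \<in> holonomy_group x0 h"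
  proof -
    obtain \<delta> where \<delta>: "path \<delta>" "\<delta> 0 = x0" "\<delta> 1 = x0" and a\<delta>: "a = h (homotopy_class \<delta>)"
      using a unfolding carr by (auto simp: loops_at_def pathstart_def pathfinish_def)
    obtain \<gamma> where \<gamma>: "continuous_on {0..1} \<gamma>" "\<gamma> 0 = xt0" "\<And>t. t \<in> {0..1} \<Longrightarrow> p (\<gamma> t) = \<delta> t"
      using covering_lift_interval[OF cov, of 0 1 \<delta> xt0] \<delta> x0 unfolding path_def by auto
    have \<gamma>': "path \<gamma>" "pathstart \<gamma> = xt0" "p (pathfinish \<gamma>) = x0"
      using \<gamma> \<delta>(3) by (simp_all add: path_def pathstart_def pathfinish_def)
    \<comment> \<open>The lift covers \<delta> on the unit interval only, so the two need not be
      equal as functions on the line; their homotopy classes are.\<close>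
    have "homotopic_paths UNIV \<delta> (p \<circ> \<gamma>)"
      using \<gamma>(3) \<delta>(1) by (intro homotopic_paths_eq) auto
    then have "homotopy_class \<delta> = homotopy_class (p \<circ> \<gamma>)"
      unfolding homotopy_class_def using homotopic_paths_trans homotopic_paths_sym by blast
    moreover obtain \<tau> where \<tau>: "\<tau> \<in> deck_transformations p" "\<tau> xt0 = pathfinish \<gamma>"
      using trans[of xt0 "pathfinish \<gamma>"] x0 \<gamma>'(3) by auto
    ultimately show ?thesis
      using hol[OF \<gamma>'(1,2) loop[OF \<gamma>'] \<tau>] \<tau>(1) unfolding a\<delta> by auto
  qed
qed

text \<open>The subgroup laws are transported from deck transformations, which compose and
  invert.\<close>

lemma subgroup_holonomy_group:
  fixes p :: "'c::{t2_space, second_countable_topology} \<Rightarrow> 'm::{t2_space, second_countable_topology}"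
    and G :: "'a::{t2_space, second_countable_topology} monoid"
  assumes dev: "development M \<omega> N G Mt p F D x0 xt0 h" and G: "group G" "carrier G = UNIV"
  shows "subgroup (holonomy_group x0 h) G"
proof -
  interpret group G by (rule G)
  note hol = holonomy_group_deck[OF dev G]
  \<comment> \<open>By cancellation in \<open>G\<close>, the effect of \<tau> on \<open>D\<close> at
    a single point already determines the translation.\<close>
  have in_hol: "a \<in> holonomy_group x0 h"
    if \<tau>: "\<tau> \<in> deck_transformations p" "D (\<tau> x) = a \<otimes>\<^bsub>G\<^esub> D x" for a \<tau> x
  proof -
    obtain b where b: "b \<in> holonomy_group x0 h" "\<forall>x. D (\<tau> x) = b \<otimes>\<^bsub>G\<^esub> D x"
      using hol(1)[OF \<tau>(1)] by blast
    then have "a \<otimes>\<^bsub>G\<^esub> D x = b \<otimes>\<^bsub>G\<^esub> D x" using \<tau>(2) by metis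
    then show ?thesis using b(1) G(2) by simp
  qed
  show ?thesis
  proof (rule subgroupI)
    have "D (id xt0) = \<one>\<^bsub>G\<^esub> \<otimes>\<^bsub>G\<^esub> D xt0" using G(2) by simp
    from in_hol[OF deck_transformations_id this] show "holonomy_group x0 h \<noteq> {}" by blast
    fix a assume a: "a \<in> holonomy_group x0 h"
    obtain \<sigma> where \<sigma>: "\<sigma> \<in> deck_transformations p" "\<forall>x. D (\<sigma> x) = a \<otimes>\<^bsub>G\<^esub> D x"
      using hol(2)[OF a] by blast
    obtain \<sigma>' where \<sigma>': "\<sigma>' \<in> deck_transformations p" "\<And>x. \<sigma> (\<sigma>' x) = x"
      using deck_transformations_inverse[OF \<sigma>(1)] by blast
    have "D xt0 = a \<otimes>\<^bsub>G\<^esub> D (\<sigma>' xt0)" using \<sigma>(2) \<sigma>'(2) by metis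
    then have "D (\<sigma>' xt0) = inv\<^bsub>G\<^esub> a \<otimes>\<^bsub>G\<^esub> D xt0"
      using G(2) by (simp add: m_assoc[symmetric])
    from in_hol[OF \<sigma>'(1) this] show "inv\<^bsub>G\<^esub> a \<in> holonomy_group x0 h" .
    fix b assume b: "b \<in> holonomy_group x0 h"
    obtain \<tau> where \<tau>: "\<tau> \<in> deck_transformations p" "\<forall>x. D (\<tau> x) = b \<otimes>\<^bsub>G\<^esub> D x"
      using hol(2)[OF b] by blast
    have "D ((\<sigma> \<circ> \<tau>) xt0) = a \<otimes>\<^bsub>G\<^esub> b \<otimes>\<^bsub>G\<^esub> D xt0"
      using \<sigma>(2) \<tau>(2) G(2) by (simp add: m_assoc)
    from in_hol[OF deck_transformations_comp[OF \<sigma>(1) \<tau>(1)] this]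
    show "a \<otimes>\<^bsub>G\<^esub> b \<in> holonomy_group x0 h" .
  qed (simp add: G(2))
qed

section \<open>The correspondence between leaves and cosets\<close>

theorem proposition5p1:
  fixes M :: "'m::{t2_space, second_countable_topology} smooth_structure"
    and br :: "'g::real_vector \<Rightarrow> 'g \<Rightarrow> 'g"
    and \<omega> :: "('m, 'g) form1"
    and N :: "'a::{t2_space, second_countable_topology} smooth_structure"
    and G :: "'a monoid"
    and Mt :: "'c::{t2_space, second_countable_topology} smooth_structure"
    and p :: "'c \<Rightarrow> 'm"
    and F :: "'f::{t2_space, second_countable_topology} smooth_structure"
    and D :: "'c \<Rightarrow> 'a"
    and x0 :: 'm and xt0 :: 'c
    and h :: "(real \<Rightarrow> 'm) set \<Rightarrow> 'a"
    and \<Gamma> :: "'a set"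
  assumes "smooth_manifold M" and "compact (UNIV :: 'm set)" and "connected (UNIV :: 'm set)"
    and "fin_dim_lie_algebra br" and "lie_foliation M br \<omega>"
    and "lie_group N G" and "connected (UNIV :: 'a set)" and "simply_connected (UNIV :: 'a set)"
    and "has_lie_algebra N G br"
    and "development M \<omega> N G Mt p F D x0 xt0 h"
    and "\<Gamma> = holonomy_group x0 h"
  shows "Diff_leaf_space M \<omega> \<cong> Diff_coset_space N G \<Gamma>"
proof -
  note dev = assms(10)
  have G: "group G" "carrier G = UNIV" "smooth_map N N (m_inv G)" and N: "charted N"
    using assms(6) smooth_manifold_imp_charted unfolding lie_group_def by auto
  have Mt: "smooth_manifold Mt" and reg: "regular_covering Mt M p" and F: "charted F"
    and D: "locally_trivial_bundle Mt N F D"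
    and leaf: "\<And>x. leaf Mt (pullback M p \<omega>) x = D -` {D x}"
    using dev smooth_manifold_imp_charted unfolding development_def by auto
  have cov: "covering_space UNIV p UNIV"
    and diffeo: "\<And>x. \<exists>W. x \<in> W \<and> diffeomorphism_on W (p ` W) Mt M p"
    and trans: "\<And>x y. p x = p y \<Longrightarrow> \<exists>\<tau>\<in>deck_transformations p. \<tau> x = y"
    using reg unfolding regular_covering_def by auto
  note M' = smooth_manifold_imp_charted[OF assms(1)] and Mt' = smooth_manifold_imp_charted[OF Mt]
  note p = smooth_map_local_diffeomorphism[OF Mt' M' diffeo]
  have surj: "surj p" "surj D"
    using covering_space_imp_surjective[OF cov] locally_trivial_bundle_surj[OF D] by auto
  have D': "smooth_map Mt N D" using D unfolding locally_trivial_bundle_def by blast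
  note hol = holonomy_group_deck[OF dev G(1,2), folded assms(11)]
  interpret group G by (rule G)
  interpret \<Gamma>: subgroup \<Gamma> G
    using subgroup_holonomy_group[OF dev G(1,2)] unfolding assms(11) .
  have leafM: "leaf M \<omega> (p y) = p ` D -` {D y}" for y
    using leaf_covering_image[OF Mt M' cov diffeo, of \<omega> y] leaf by simp
  have pdeck: "p (\<tau> x) = p x" if "\<tau> \<in> deck_transformations p" for \<tau> x
    using that unfolding deck_transformations_def by (auto simp: fun_eq_iff)

  \<comment> \<open>Both maps are built from images and preimages of sets, so no representative is
    chosen and well-definedness does not arise.\<close>
  define \<Phi> where "\<Phi> L = m_inv G ` D ` p -` L" for L
  define \<Psi> where "\<Psi> C = p ` D -` m_inv G ` C" for C
  let ?C = "\<lambda>g. g <#\<^bsub>G\<^esub> \<Gamma>"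
  have inv_rcos: "m_inv G ` (\<Gamma> #>\<^bsub>G\<^esub> g) = ?C (inv\<^bsub>G\<^esub> g)" for g
  proof -
    have "\<Gamma> #>\<^bsub>G\<^esub> g = (\<lambda>a. a \<otimes>\<^bsub>G\<^esub> g) ` \<Gamma>"
      by (auto simp: r_coset_def)
    then have "m_inv G ` (\<Gamma> #>\<^bsub>G\<^esub> g) = (\<lambda>a. inv\<^bsub>G\<^esub> g \<otimes>\<^bsub>G\<^esub> a) ` m_inv G ` \<Gamma>"
      using G(2) by (simp add: image_image inv_mult_group)
    moreover have "m_inv G ` \<Gamma> = \<Gamma>"
    proof (intro equalityI subsetI)
      fix a assume "a \<in> \<Gamma>"
      then show "a \<in> m_inv G ` \<Gamma>" by (intro image_eqI[of _ _ "inv\<^bsub>G\<^esub> a"]) auto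
    qed auto
    ultimately show ?thesis by (auto simp: l_coset_def)
  qed
  have \<Phi>_leaf: "\<Phi> (leaf M \<omega> (p y)) = ?C (inv\<^bsub>G\<^esub> (D y))" for y
  proof -
    \<comment> \<open>Saturating a fibre of \<open>D\<close> under \<open>p\<close> adds exactly its
      deck translates, by regularity, and \<open>D\<close> sends these to the translates of
      \<open>D y\<close> by \<Gamma>.\<close>
    have "D ` p -` (p ` D -` {D y}) = \<Gamma> #>\<^bsub>G\<^esub> D y"
    proof (intro equalityI subsetI)
      fix g assume "g \<in> D ` p -` (p ` D -` {D y})"
      then obtain z z' where z: "g = D z" "p z' = p z" "D z' = D y" by force
      obtain \<tau> where \<tau>: "\<tau> \<in> deck_transformations p" "\<tau> z' = z" using trans[OF z(2)] by blast
      obtain a where "a \<in> \<Gamma>" "\<forall>x. D (\<tau> x) = a \<otimes>\<^bsub>G\<^esub> D x" using hol(1)[OF \<tau>(1)] by blast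
      then show "g \<in> \<Gamma> #>\<^bsub>G\<^esub> D y" unfolding r_coset_def using z \<tau>(2) by auto
    next
      fix g assume "g \<in> \<Gamma> #>\<^bsub>G\<^esub> D y"
      then obtain a where a: "a \<in> \<Gamma>" "g = a \<otimes>\<^bsub>G\<^esub> D y" unfolding r_coset_def by auto
      obtain \<tau> where \<tau>: "\<tau> \<in> deck_transformations p" "\<forall>x. D (\<tau> x) = a \<otimes>\<^bsub>G\<^esub> D x"
        using hol(2)[OF a(1)] by blast
      show "g \<in> D ` p -` (p ` D -` {D y})"
        using pdeck[OF \<tau>(1)] \<tau>(2) a(2) by (intro image_eqI[of _ _ "\<tau> y"]) auto
    qed
    then show ?thesis unfolding \<Phi>_def leafM using inv_rcos by simp
  qed
  have \<Psi>_coset: "\<Psi> (?C (inv\<^bsub>G\<^esub> (D y))) = leaf M \<omega> (p y)" for y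
  proof -
    have "m_inv G ` ?C (inv\<^bsub>G\<^esub> (D y)) = \<Gamma> #>\<^bsub>G\<^esub> D y"
      unfolding inv_rcos[symmetric] using G(2) by (simp add: image_image)
    moreover have "p ` D -` (\<Gamma> #>\<^bsub>G\<^esub> D y) = leaf M \<omega> (p y)"
    proof (intro equalityI subsetI)
      fix x assume "x \<in> p ` D -` (\<Gamma> #>\<^bsub>G\<^esub> D y)"
      then obtain z a where z: "x = p z" "a \<in> \<Gamma>" "D z = a \<otimes>\<^bsub>G\<^esub> D y" unfolding r_coset_def by auto
      obtain \<tau> where \<tau>: "\<tau> \<in> deck_transformations p" "\<forall>x. D (\<tau> x) = a \<otimes>\<^bsub>G\<^esub> D x"
        using hol(2)[OF z(2)] by blast
      \<comment> \<open>Here \<open>D z\<close> equals \<open>D\<close> (\<tau> \<open>y\<close>),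
        so \<open>x\<close> lies on the leaf through \<open>p\<close> (\<tau> \<open>y\<close>),
        which is \<open>p y\<close>.\<close>
      then have "x \<in> p ` D -` {D (\<tau> y)}" using z by auto
      then show "x \<in> leaf M \<omega> (p y)" unfolding leafM[symmetric] using pdeck[OF \<tau>(1)] by simp
    next
      fix x assume "x \<in> leaf M \<omega> (p y)"
      moreover have "D y \<in> \<Gamma> #>\<^bsub>G\<^esub> D y"
        unfolding r_coset_def using \<Gamma>.one_closed G(2) by force
      ultimately show "x \<in> p ` D -` (\<Gamma> #>\<^bsub>G\<^esub> D y)" unfolding leafM by auto
    qed
    ultimately show ?thesis unfolding \<Psi>_def by simp
  qed
  \<comment> \<open>Surjectivity of \<open>p\<close> and \<open>D\<close> lets points of
    \<open>Mt\<close> index all leaves and all cosets, so the two formulas above make \<Phi> and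
    \<Psi> mutually inverse.\<close>
  have leaves: "\<exists>y. L = leaf M \<omega> (p y)" if "L \<in> range (leaf M \<omega>)" for L
    using that surj(1) by (metis rangeE surjD)
  have "\<exists>y. g = inv\<^bsub>G\<^esub> (D y)" for g
    using surj(2) inv_inv[of g] G(2) by (metis UNIV_I surjD)
  then have cosets: "\<exists>y. C = ?C (inv\<^bsub>G\<^esub> (D y))" if "C \<in> lcosets\<^bsub>G\<^esub> \<Gamma>" for C
    using that unfolding LCOSETS_def by (metis UN_E singletonD)
  have lcosets: "lcosets\<^bsub>G\<^esub> \<Gamma> = range ?C"
    unfolding LCOSETS_def G(2) by auto
  show ?thesis
    unfolding Diff_leaf_space_def Diff_coset_space_def
  proof (rule Diff_group_iso[where \<Phi> = \<Phi> and \<Psi> = \<Psi>])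
    show "diffeology_on (range (leaf M \<omega>)) (quotient_diffeology M (leaf M \<omega>))"
      by (rule diffeology_on_quotient)
    show "diffeology_on (lcosets\<^bsub>G\<^esub> \<Gamma>) (quotient_diffeology N ?C)"
      unfolding lcosets by (rule diffeology_on_quotient)
    show "\<Phi> L \<in> lcosets\<^bsub>G\<^esub> \<Gamma>" "\<Psi> (\<Phi> L) = L" if "L \<in> range (leaf M \<omega>)" for L
      using leaves[OF that] \<Phi>_leaf \<Psi>_coset unfolding lcosets by auto
    show "\<Psi> C \<in> range (leaf M \<omega>)" "\<Phi> (\<Psi> C) = C" if "C \<in> lcosets\<^bsub>G\<^esub> \<Gamma>" for C
      using cosets[OF that] \<Phi>_leaf \<Psi>_coset by auto
    show "differentiable_map (quotient_diffeology M (leaf M \<omega>)) (quotient_diffeology N ?C) \<Phi>"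
    proof (rule differentiable_map_quotient)
      fix n U u and s :: "(nat \<Rightarrow> real) \<Rightarrow> 'm" assume s: "smooth_into M n U s" and u: "u \<in> U"
      \<comment> \<open>A local lift through \<open>p\<close>, followed by \<open>D\<close> and
        inversion, represents the image plot.\<close>
      obtain V l where V: "u \<in> V" "V \<subseteq> U" "smooth_into Mt n V l" "\<And>v. v \<in> V \<Longrightarrow> p (l v) = s v"
        using smooth_into_local_lift[OF Mt' M' surj(1) diffeo s u] by blast
      have "smooth_into N n V (\<lambda>v. inv\<^bsub>G\<^esub> (D (l v)))"
        using smooth_into_compose[OF N N smooth_into_compose[OF Mt' N V(3) D'] G(3)] by simp
      moreover have "?C (inv\<^bsub>G\<^esub> (D (l v))) = \<Phi> (leaf M \<omega> (s v))" if "v \<in> V" for v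
        using \<Phi>_leaf[of "l v"] V(4)[OF that] by simp
      ultimately show "\<exists>V t. u \<in> V \<and> V \<subseteq> U \<and> smooth_into N n V t \<and> (\<forall>v\<in>V. ?C (t v) = \<Phi> (leaf M \<omega> (s v)))"
        using V(1,2) by blast
    qed
    show "differentiable_map (quotient_diffeology N ?C) (quotient_diffeology M (leaf M \<omega>)) \<Psi>"
    proof (rule differentiable_map_quotient)
      fix n U u and s :: "(nat \<Rightarrow> real) \<Rightarrow> 'a" assume s: "smooth_into N n U s" and u: "u \<in> U"
      \<comment> \<open>The section is taken over the inverses, because the point \<open>y\<close>
        corresponds to the coset of the inverse of \<open>D y\<close>.\<close>
      have "smooth_into N n U (\<lambda>v. inv\<^bsub>G\<^esub> (s v))"
        using smooth_into_compose[OF N N s G(3)] by simp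
      then obtain V l where V: "u \<in> V" "V \<subseteq> U" "smooth_into Mt n V l" "\<And>v. v \<in> V \<Longrightarrow> D (l v) = inv\<^bsub>G\<^esub> (s v)"
        using locally_trivial_bundle_local_section[OF Mt' N F D _ u] by blast
      have "smooth_into M n V (\<lambda>v. p (l v))"
        using smooth_into_compose[OF Mt' M' V(3) p] by simp
      moreover have "leaf M \<omega> (p (l v)) = \<Psi> (?C (s v))" if "v \<in> V" for v
        using \<Psi>_coset[of "l v"] V(4)[OF that] G(2) by simp
      ultimately show "\<exists>V t. u \<in> V \<and> V \<subseteq> U \<and> smooth_into M n V t \<and> (\<forall>v\<in>V. leaf M \<omega> (t v) = \<Psi> (?C (s v)))"
        using V(1,2) by blast
    qed
  qed
qed

end
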